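(* Let $S=\{\eta_1,\dots,\eta_m\}$ be a mod $2$ cyclotomic relation of weight $m \le 18$. Then there exist signs $\sigma_1,\dots,\sigma_m \in \{\pm 1\}$ such that $\sigma_1\eta_1+\cdots+\sigma_m\eta_m = 0$.
   Context: Let $\mu \subset \mathbb{C}$ be the multiplicative group of all roots of unity and $\mathbb{Z}[\mu]\subset\mathbb{C}$ the ring of cyclotomic integers. A mod $2$ cyclotomic relation is a finite multisubset (subset with multiplicity) of $\mu$ whose sum (with multiplicity) is divisible by $2$ in $\mathbb{Z}[\mu]$. Its weight is its cardinality (with multiplicity). *)

theory Defs
  imports Complex_Main "HOL-Library.Multiset" "HOL-Algebra.Generated_Rings"
    "HOL-Decision_Procs.Algebra_Aux"
begin

definition roots_of_unity :: "complex set" where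
  "roots_of_unity = {z. \<exists>n::nat. n > 0 \<and> z ^ n = 1}"

text \<open>Here \<^const>\<open>cring_class_ops\<close> is the type of complex numbers, with its type-class operations,
  viewed as a ring record with full carrier.\<close>

definition cyclotomic_integers :: "complex set" where
  "cyclotomic_integers = generate_ring cring_class_ops roots_of_unity"

definition mod2_cyclotomic_relation :: "complex multiset \<Rightarrow> bool" where
  "mod2_cyclotomic_relation S \<longleftrightarrow>
     set_mset S \<subseteq> roots_of_unity \<and> (\<exists>y\<in>cyclotomic_integers. \<Sum>\<^sub># S = 2 * y)"

text \<open>The weight of a relation is \<^const>\<open>size\<close>, the cardinality with multiplicity.\<close>

end

theory Submission
  imports Defs "HOL-Computational_Algebra.Polynomial_Factorial" "HOL-Number_Theory.Number_Theory"
begin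

text \<open>
  All roots in a relation have order dividing some \<open>N\<close>, and the proof removes prime factors from \<open>N\<close>
  one at a time. The tool is linear independence, which rests on the irreducibility of cyclotomic
  polynomials (\<open>conjugate\<close>): write \<open>N = p * n\<close> and split the relation as a union of \<open>w\<^sup>i S\<^sub>i\<close>, \<open>i < p\<close>, with
  all \<open>S\<^sub>i\<close> of order dividing \<open>n\<close>. If \<open>p\<close> divides \<open>n\<close>, take \<open>w = \<zeta>\<^sub>N\<close>; then every \<open>S\<^sub>i\<close> is a relation by
  itself (\<open>cong2_ramified\<close>). If not, take \<open>w = \<zeta>\<^sub>p\<close>; then the sums of the \<open>S\<^sub>i\<close> are all congruent
  modulo \<open>2\<close> (\<open>cong2_unramified\<close>), and it suffices to find signs that give all \<open>S\<^sub>i\<close> the same value, because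
  the \<open>p\<close>-th roots of unity sum to zero. For \<open>p = 2\<close> a change of signs moves the whole relation to order \<open>n\<close>.

  A common value is easy to find if some \<open>S\<^sub>i\<close> has at most one element (\<open>signed_sum_of_small_part\<close>): if it is
  empty, all \<open>S\<^sub>i\<close> are relations, and if it is \<open>{u}\<close>, then \<open>S\<^sub>j\<close> together with \<open>u\<close> is one for every \<open>j\<close>. This
  always happens if \<open>2 * p > 18\<close>. Hence only divisors of \<open>105\<close> remain.

  For order \<open>3\<close> the residue ring modulo \<open>2\<close> is the field with four elements, and a multiset of cube
  roots of unity can be signed to the representative of its class among \<open>0, 1, \<zeta>\<^sub>3, \<zeta>\<^sub>3\<^sup>2\<close>
  (\<open>reduce_cube_roots\<close>). So for order \<open>15\<close> a multiset is described by a vector of five such representatives,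
  with free signs, up to a constant vector. Relations have constant vectors and lift for
  every weight (\<open>liftable_15\<close>).

  For order \<open>105\<close> there are seven parts of order dividing \<open>15\<close>, without loss of generality of size at
  least two. As \<open>18 < 21\<close>, one of them is a pair. If signs can give the sum of the pair or its difference to
  all other parts as well, a common value is found. In the decisive case, computing with the
  coordinate vectors (\<open>lift_pair_class\<close>) shows that a part to which the sum cannot be given has at least
  four elements, and one to which the difference cannot be given has at least five. Two parts with opposite
  demands would thus force the weight to be at least \<open>4 + 5 + 5 * 2 = 19\<close> (\<open>common_lift\<close>).
\<close>

section \<open>Integer polynomials at roots of unity and their conjugates\<close>

definition ev :: "int poly \<Rightarrow> complex \<Rightarrow> complex" where
  "ev p z = poly (map_poly of_int p) z"

lemma ev_0 [simp]: "ev 0 z = 0"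
  by (simp add: ev_def)

lemma ev_pCons [simp]: "ev (pCons a p) z = of_int a + z * ev p z"
  by (simp add: ev_def map_poly_pCons)

lemma ev_1 [simp]: "ev 1 z = 1"
  by (simp add: one_pCons)

lemma ev_add [simp]: "ev (p + q) z = ev p z + ev q z"
proof (induction p arbitrary: q)
  case (pCons a p)
  obtain b q' where q: "q = pCons b q'" by (cases q)
  show ?case unfolding q using pCons.IH[of q'] by (simp add: algebra_simps)
qed simp

lemma ev_smult [simp]: "ev (smult a p) z = of_int a * ev p z"
  by (induction p) (simp_all add: algebra_simps)

lemma ev_uminus [simp]: "ev (- p) z = - ev p z"
  by (induction p) (simp_all add: algebra_simps)

lemma ev_diff [simp]: "ev (p - q) z = ev p z - ev q z"
  using ev_add[of p "- q"] by simp

lemma ev_mult [simp]: "ev (p * q) z = ev p z * ev q z"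
  by (induction p) (simp_all add: algebra_simps)

lemma ev_monom [simp]: "ev (monom a n) z = of_int a * z ^ n"
  by (simp add: ev_def map_poly_monom poly_monom)

lemma ev_sum: "ev (\<Sum>i\<in>A. p i) z = (\<Sum>i\<in>A. ev (p i) z)"
  by (induction A rule: infinite_finite_induct) simp_all

lemma ev_pcompose: "ev (pcompose p q) z = ev p (ev q z)"
  by (induction p) (simp_all add: pcompose_pCons)

text \<open>
  Frobenius modulo \<open>q\<close>: raising to the \<open>q\<close>-th power is additive up to multiples of \<open>q\<close> and fixes the
  integer coefficients by Fermat's little theorem. The error term is again an integer polynomial
  in \<open>z\<close>, which is what makes the divisibility by \<open>q\<close> usable below.
\<close>
lemma ev_frobenius:
  assumes "prime q"
  shows "\<exists>g. ev p (z ^ q) = (ev p z) ^ q + of_nat q * ev g z"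
proof (induction p)
  case 0
  have "q > 0" using assms by (simp add: prime_gt_0_nat)
  thus ?case by (intro exI[of _ 0]) simp
next
  case (pCons a p)
  then obtain g where g: "ev p (z ^ q) = (ev p z) ^ q + of_nat q * ev g z" by blast
  have q: "q > 0" using assms by (simp add: prime_gt_0_nat)
  define P where "P = pCons 0 p"
  have P: "ev P z = z * ev p z" by (simp add: P_def)
  have fermat: "\<exists>b::int. a ^ q = a + int q * b"
  proof -
    have "[a ^ q = a] (mod int q)"
    proof (cases "int q dvd a")
      case True
      hence "int q dvd a ^ q" using q by (simp add: dvd_power_iff dvd_trans[OF _ dvd_power])
      thus ?thesis using True by (simp add: cong_def mod_eq_0_iff_dvd)
    next
      case False
      have "prime (int q)" using assms by simp
      hence "coprime (int q) a" using False by (intro prime_imp_coprime) auto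
      have "[nat (a mod int q) ^ (q - 1) = 1] (mod q)"
      proof (rule fermat_theorem[OF assms])
        show "\<not> q dvd nat (a mod int q)"
        proof
          assume "q dvd nat (a mod int q)"
          hence "int q dvd int (nat (a mod int q))" by (simp only: int_dvd_int_iff)
          hence "int q dvd a" using q by (simp add: dvd_mod_iff)
          thus False using False by simp
        qed
      qed
      hence "[int (nat (a mod int q) ^ (q - 1)) = int 1] (mod int q)"
        using cong_int_iff by blast
      hence "[(a mod int q) ^ (q - 1) = 1] (mod int q)" using q by simp
      hence "[a ^ (q - 1) = 1] (mod int q)" by (simp add: cong_def power_mod)
      hence "[a * a ^ (q - 1) = a * 1] (mod int q)" by (rule cong_scalar_left)
      thus ?thesis using q by (cases q) auto
    qed
    hence "int q dvd a ^ q - a" by (simp add: cong_iff_dvd_diff)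
    then obtain b where "a ^ q - a = int q * b" by (auto elim: dvdE)
    thus ?thesis by (intro exI[of _ b]) simp
  qed
  then obtain b where b: "a ^ q = a + int q * b" by blast
  have b': "of_int a ^ q = (of_int a + of_nat q * of_int b :: complex)"
    using arg_cong[OF b, of "of_int :: int \<Rightarrow> complex"] by simp
  define G where "G = (\<Sum>k\<in>{1..<q}. smult (int ((q choose k) div q) * a ^ k) (P ^ (q - k)))"
  have pow: "ev (P ^ n) z = ev P z ^ n" for n
    by (induction n) simp_all
  have "(of_int a + ev P z) ^ q
      = (\<Sum>k\<le>q. of_nat (q choose k) * of_int a ^ k * ev P z ^ (q - k))"
    by (rule binomial_ring)
  also have "{..q} = insert 0 (insert q {1..<q})" using q by auto
  also have "(\<Sum>k\<in>\<dots>. of_nat (q choose k) * of_int a ^ k * ev P z ^ (q - k))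
     = ev P z ^ q + of_int a ^ q + (\<Sum>k\<in>{1..<q}. of_nat (q choose k) * of_int a ^ k * ev P z ^ (q - k))"
    using q by simp
  also have "(\<Sum>k\<in>{1..<q}. of_nat (q choose k) * of_int a ^ k * ev P z ^ (q - k)) = of_nat q * ev G z"
    unfolding G_def ev_sum sum_distrib_left
  proof (intro sum.cong refl)
    fix k assume k: "k \<in> {1..<q}"
    have "q dvd (q choose k)" using k assms by (intro dvd_choose_prime) auto
    hence "(of_nat (q choose k) :: complex) = of_nat q * of_nat ((q choose k) div q)"
      by (simp flip: of_nat_mult)
    thus "of_nat (q choose k) * of_int a ^ k * ev P z ^ (q - k) =
      of_nat q * ev (smult (int ((q choose k) div q) * a ^ k) (P ^ (q - k))) z"
      by (simp add: pow mult_ac)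
  qed
  finally have "(of_int a + z * ev p z) ^ q = z ^ q * ev p z ^ q + of_int a + of_nat q * (of_int b + ev G z)"
    by (simp add: P power_mult_distrib b' algebra_simps)
  thus ?case
    by (intro exI[of _ "monom 1 q * g - [:b:] - G"]) (simp add: g algebra_simps)
qed

text \<open>
  A primitive integer polynomial of least degree vanishing at \<open>z\<close> divides every annihilator of \<open>z\<close>:
  pseudo-division leaves no remainder, and by Gauss's lemma the scaling factor that it introduces can
  be cancelled. As it divides \<open>X\<^sup>N - 1\<close>, its leading coefficient is a unit. In other words it is, up
  to sign, the minimal polynomial of \<open>z\<close>, and \<open>\<int>[z]\<close> is free over \<open>\<int>\<close>.
\<close>
lemma primitive_annihilator:
  fixes z :: complex
  assumes "N > 0" "z ^ N = 1"
  obtains f :: "int poly" where "ev f z = 0" "lead_coeff f dvd 1"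
    "\<And>g. ev g z = 0 \<Longrightarrow> f dvd g" "degree f > 0"
proof -
  define X :: "int poly" where "X = monom 1 N - 1"
  have X: "ev X z = 0" using assms by (simp add: X_def)
  have "coeff X N = 1" using assms by (simp add: X_def)
  hence X0: "X \<noteq> 0" by auto
  have degX: "degree X = N"
  proof (rule antisym)
    show "degree X \<le> N" unfolding X_def by (intro degree_diff_le degree_monom_le) simp
    show "N \<le> degree X" using \<open>coeff X N = 1\<close> by (intro le_degree) simp
  qed
  define Q where "Q = (\<lambda>f::int poly. f \<noteq> 0 \<and> ev f z = 0)"
  define f0 where "f0 = arg_min degree Q"
  have "Q X" using X X0 by (simp add: Q_def)
  hence f0: "Q f0" and min: "\<And>g. Q g \<Longrightarrow> degree f0 \<le> degree g"
    unfolding f0_def by (auto intro: arg_min_natI arg_min_nat_le)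
  define f where "f = primitive_part f0"
  have f0_eq: "f0 = smult (content f0) f" by (simp add: f_def)
  have c0: "content f0 \<noteq> 0" using f0 by (simp add: Q_def)
  have f: "f \<noteq> 0" using f0 by (simp add: f_def Q_def)
  have ef: "ev f z = 0" using f0 c0 arg_cong[OF f0_eq, of "\<lambda>p. ev p z"] by (auto simp: Q_def)
  have degf: "degree f = degree f0" by (simp add: f_def)
  have cf: "content f = 1" using f0 by (simp add: f_def Q_def)
  have dvd: "f dvd g" if g: "ev g z = 0" for g
  proof -
    from pseudo_mod[OF f, of g] obtain a q where a: "a \<noteq> 0"
      and eq: "smult a g = f * q + pseudo_mod g f" by blast
    have r: "pseudo_mod g f = 0 \<or> degree (pseudo_mod g f) < degree f" by (rule pseudo_mod[OF f])
    have "ev (pseudo_mod g f) z = 0"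
      using arg_cong[OF eq, of "\<lambda>p. ev p z"] g ef by simp
    hence "pseudo_mod g f = 0"
      using min[of "pseudo_mod g f"] r degf unfolding Q_def by linarith
    hence eq: "smult a g = f * q" using eq by simp
    have "content q = content (f * q)" by (simp add: content_mult cf)
    also have "\<dots> = normalize a * content g" by (simp flip: eq)
    finally have "a dvd content q" by simp
    hence "[:a:] dvd q" by (simp add: const_poly_dvd_iff_dvd_content)
    then obtain q' where "q = [:a:] * q'" by (rule dvdE)
    hence "q = smult a q'" by simp
    hence "smult a g = smult a (f * q')" using eq by simp
    hence "smult a (g - f * q') = 0" by (simp add: smult_diff_right)
    hence "g = f * q'" using a by simp
    thus ?thesis by simp
  qed
  from dvd[OF X] obtain h where h: "X = f * h" by (auto elim: dvdE)
  have "lead_coeff X = lead_coeff f * lead_coeff h" unfolding h by (rule lead_coeff_mult)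
  moreover have "lead_coeff X = 1" using degX \<open>coeff X N = 1\<close> by simp
  ultimately have lc: "lead_coeff f dvd 1" by (metis dvd_triv_left)
  have "degree f > 0"
  proof (rule ccontr)
    assume "\<not> degree f > 0"
    then obtain c where "f = [:c:]" by (metis degree_eq_zeroE gr0I)
    thus False using ef f by simp
  qed
  with that ef lc dvd show thesis by blast
qed

text \<open>
  No prime is invertible in \<open>\<int>[z]\<close>. Take \<open>g\<close> of least degree with \<open>q * g(z) = 1\<close>. Then \<open>q * g - 1\<close> is a
  multiple of the minimal polynomial \<open>f\<close>, whose leading coefficient is a unit, so the leading term
  of \<open>g\<close> can be removed by subtracting a multiple of \<open>f\<close>, contradicting minimality.
\<close>
lemma inverse_prime_notin:
  assumes "N > 0" "z ^ N = 1" "prime (q::nat)"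
  shows "of_nat q * ev g z \<noteq> 1"
proof
  assume g: "of_nat q * ev g z = 1"
  obtain f :: "int poly" where f: "ev f z = 0" "lead_coeff f dvd 1"
    "\<And>g. ev g z = 0 \<Longrightarrow> f dvd g" "degree f > 0"
    using primitive_annihilator[OF assms(1,2)] by metis
  define Q where "Q = (\<lambda>g. of_nat q * ev g z = 1)"
  define g' where "g' = arg_min degree Q"
  have "Q g" using g by (simp add: Q_def)
  hence g': "Q g'" and min: "\<And>g. Q g \<Longrightarrow> degree g' \<le> degree g"
    unfolding g'_def by (auto intro: arg_min_natI arg_min_nat_le)
  have "f dvd smult (int q) g' - 1" using g' by (intro f(3)) (simp add: Q_def)
  then obtain h where h: "smult (int q) g' - 1 = f * h" by (auto elim: dvdE)
  have q1: "q > 1" using assms(3) prime_gt_1_nat by blast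
  have nz: "smult (int q) g' - 1 \<noteq> 0"
  proof
    assume "smult (int q) g' - 1 = 0"
    hence "coeff (smult (int q) g' - 1) 0 = 0" by simp
    hence "int q * coeff g' 0 = 1" by simp
    hence "int q dvd 1" by (metis dvd_triv_left)
    thus False using q1 by simp
  qed
  hence h0: "h \<noteq> 0" and f0: "f \<noteq> 0" using h by auto
  have deg: "degree (smult (int q) g' - 1) = degree f + degree h"
    unfolding h using f0 h0 by (rule degree_mult_eq)
  hence degpos: "degree (smult (int q) g' - 1) > 0" using f by simp
  have "degree (smult (int q) g' - 1) \<le> max (degree (smult (int q) g')) (degree (1::int poly))"
    by (rule degree_diff_le_max)
  hence degle: "degree (smult (int q) g' - 1) \<le> degree g'" using q1 by (simp split: if_splits)
  define d where "d = degree g'"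
  have degd: "degree (smult (int q) g' - 1) = d"
  proof (rule antisym)
    have "d > 0" using degle degpos by (simp add: d_def)
    hence "coeff (smult (int q) g' - 1) d = int q * coeff g' d" by simp
    moreover have "coeff g' d \<noteq> 0" using \<open>d > 0\<close> unfolding d_def by (metis degree_0 leading_coeff_neq_0 less_irrefl)
    ultimately show "d \<le> degree (smult (int q) g' - 1)" using q1 by (intro le_degree) simp
  qed (use degle in \<open>simp add: d_def\<close>)
  have "d > 0" using degd degpos by simp
  have "lead_coeff (smult (int q) g' - 1) = lead_coeff f * lead_coeff h"
    unfolding h by (rule lead_coeff_mult)
  hence lc: "int q * coeff g' d = lead_coeff f * lead_coeff h" using degd \<open>d > 0\<close> by simp
  from f(2) obtain e where e: "1 = lead_coeff f * e" by (rule dvdE)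
  have e2: "lead_coeff h = int q * (e * coeff g' d)"
    by (metis e lc mult.commute mult.left_commute mult_1)
  \<comment> \<open>The leading coefficient of \<open>f\<close> has inverse \<open>e\<close>, so this cancels the leading term of \<open>g'\<close>.\<close>
  define g2 where "g2 = g' - monom (e * coeff g' d) (degree h) * f"
  have "Q g2" using g' f(1) by (simp add: Q_def g2_def)
  hence "d \<le> degree g2" using min d_def by blast
  have "degree (monom (e * coeff g' d) (degree h) * f) \<le> d"
    using degree_mult_le[of "monom (e * coeff g' d) (degree h)" f]
      degree_monom_le[of "e * coeff g' d" "degree h"] deg degd by linarith
  hence "degree g2 \<le> d" unfolding g2_def by (intro degree_diff_le) (auto simp: d_def)
  hence "degree g2 = d" using \<open>d \<le> degree g2\<close> by simp
  have dd: "d = degree h + degree f" using deg degd by simp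
  have "coeff (monom (e * coeff g' d) (degree h) * f) d = e * coeff g' d * lead_coeff f"
    unfolding dd by (subst coeff_monom_mult) simp
  hence "coeff g2 d = 0" using e by (simp add: g2_def mult_ac)
  thus False using \<open>degree g2 = d\<close> \<open>d > 0\<close> by (metis degree_0 leading_coeff_neq_0 less_irrefl)
qed

text \<open>
  Dedekind's argument. Let \<open>f\<close> be the minimal polynomial of \<open>z\<close> and \<open>X\<^sup>N - 1 = f * h\<close>. If \<open>f\<close> did not vanish
  at \<open>z\<^sup>q\<close>, then \<open>h\<close> would, and differentiating gives \<open>N * z ^ (q * (N - 1)) = f(z\<^sup>q) * h'(z\<^sup>q)\<close>. By Frobenius \<open>f(z\<^sup>q)\<close> is a
  multiple of \<open>q\<close> in \<open>\<int>[z]\<close>, so \<open>q\<close> divides \<open>N\<close> there; as \<open>q\<close> is prime to \<open>N\<close>, it would be invertible.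
\<close>
lemma conjugate_prime:
  assumes N: "N > 0" "z ^ N = 1" and q: "prime (q::nat)" "\<not> q dvd N" and g: "ev g z = 0"
  shows "ev g (z ^ q) = 0"
proof -
  obtain f :: "int poly" where f: "ev f z = 0" "\<And>g. ev g z = 0 \<Longrightarrow> f dvd g"
    using primitive_annihilator[OF assms(1,2)] by metis
  have "ev f (z ^ q) = 0"
  proof (rule ccontr)
    assume nz: "ev f (z ^ q) \<noteq> 0"
    have zq: "(z ^ q) ^ N = 1" using N(2) by (metis mult.commute power_mult power_one)
    have "f dvd monom 1 N - 1" using N by (intro f(2)) simp
    then obtain h where h: "monom 1 N - 1 = f * h" by (auto elim: dvdE)
    have "ev (f * h) (z ^ q) = 0" unfolding h[symmetric] using zq by simp
    hence hz: "ev h (z ^ q) = 0" using nz by simp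
    have "pderiv (monom 1 N - 1) = pderiv (f * h)" using h by simp
    hence "monom (of_nat N) (N - 1) = f * pderiv h + h * pderiv f"
      by (simp add: pderiv_diff pderiv_monom pderiv_mult)
    from arg_cong[OF this, of "\<lambda>p. ev p (z ^ q)"]
    have e1: "of_nat N * (z ^ q) ^ (N - 1) = ev f (z ^ q) * ev (pderiv h) (z ^ q)"
      using hz by simp
    obtain u where "ev f (z ^ q) = ev f z ^ q + of_nat q * ev u z"
      using ev_frobenius[OF q(1)] by blast
    hence fu: "ev f (z ^ q) = of_nat q * ev u z" using f(1) q(1) by (simp add: prime_gt_0_nat)
    have "(z ^ q) ^ (N - 1) * z ^ q = 1" using zq N(1) by (metis power_minus_mult)
    hence "of_nat N = ev f (z ^ q) * ev (pderiv h) (z ^ q) * z ^ q"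
      using e1 by (metis mult.assoc mult.right_neutral)
    also have "\<dots> = of_nat q * ev (u * pcompose (pderiv h) (monom 1 q) * monom 1 q) z"
      by (simp add: fu ev_pcompose)
    finally obtain w where w: "(of_nat N :: complex) = of_nat q * ev w z" by blast
    have "coprime (int N) (int q)" using q by (metis coprime_commute coprime_int_iff prime_imp_coprime)
    then obtain a b where ab: "a * int N + b * int q = 1"
      by (metis bezout_int coprime_imp_gcd_eq_1)
    have "(1::complex) = of_int a * of_nat N + of_int b * of_nat q"
      using arg_cong[OF ab, of "of_int :: int \<Rightarrow> complex"] by simp
    also have "\<dots> = of_nat q * ev (smult a w + [:b:]) z" by (simp add: w algebra_simps)
    finally show False using inverse_prime_notin[OF N q(1)] by metis
  qed
  moreover obtain k where "g = f * k" using f(2)[OF g] by (auto elim: dvdE)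
  ultimately show ?thesis by simp
qed

text \<open>
  This is irreducibility of the cyclotomic polynomials in the form in which it is used: integral
  relations among powers of \<open>z\<close> persist under the Galois conjugations \<open>z \<mapsto> z\<^sup>k\<close>.
\<close>
lemma conjugate:
  assumes N: "N > 0" and z: "z ^ N = 1" and "coprime k N" "k > 0" and g: "ev g z = 0"
  shows "ev g (z ^ k) = 0"
  using assms(3,4) z g
proof (induction k arbitrary: z rule: less_induct)
  case (less k)
  show ?case
  proof (cases "k = 1")
    case False
    then obtain q where q: "prime q" "q dvd k" using prime_factor_nat by blast
    then obtain l where l: "k = q * l" by (auto elim: dvdE)
    have "l < k" "l > 0" using l less.prems q prime_gt_1_nat by auto
    have cop: "coprime q N" "coprime l N" using less.prems l by auto
    have "\<not> q dvd N" using cop(1) q(1) by (metis coprime_absorb_left not_prime_unit)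
    hence "ev g (z ^ q) = 0" using conjugate_prime[OF N less.prems(3) q(1)] less.prems by blast
    moreover have "(z ^ q) ^ N = 1" using less.prems(3) by (metis mult.commute power_mult power_one)
    ultimately have "ev g ((z ^ q) ^ l) = 0" using less.IH[OF \<open>l < k\<close> cop(2) \<open>l > 0\<close>] by blast
    thus ?thesis by (simp add: l power_mult)
  qed (use less.prems in simp)
qed

section \<open>Roots of unity and the rings they generate\<close>

definition \<zeta> :: "nat \<Rightarrow> complex" where
  "\<zeta> n = cis (2 * pi / real n)"

definition \<mu> :: "nat \<Rightarrow> complex set" where
  "\<mu> n = {z. z ^ n = 1}"

text \<open>
  The ring \<open>\<int>[\<mu>\<^sub>n]\<close>. Elements are written as differences of sums of roots, so that
  a decomposition of multisets of roots of unity carries over to ring elements.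
\<close>
definition cyclo :: "nat \<Rightarrow> complex set" where
  "cyclo n = {\<Sum>\<^sub># A - \<Sum>\<^sub># B |A B. set_mset A \<subseteq> \<mu> n \<and> set_mset B \<subseteq> \<mu> n}"

definition cong2 :: "nat \<Rightarrow> complex \<Rightarrow> complex \<Rightarrow> bool" where
  "cong2 n x y \<longleftrightarrow> (\<exists>r\<in>cyclo n. x - y = 2 * r)"

lemma \<zeta>_power: "\<zeta> n ^ k = cis (2 * pi * real k / real n)"
  by (simp add: \<zeta>_def DeMoivre mult_ac)

lemma \<zeta>_power_self [simp]: "n > 0 \<Longrightarrow> \<zeta> n ^ n = 1"
  by (simp add: \<zeta>_power)

lemma \<zeta>_nonzero [simp]: "\<zeta> n \<noteq> 0"
  by (simp add: \<zeta>_def)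

lemma \<zeta>_mult_power: "p > 0 \<Longrightarrow> \<zeta> (p * n) ^ p = \<zeta> n"
  by (simp add: \<zeta>_power) (simp add: \<zeta>_def)

lemma \<zeta>_mult_power': "n > 0 \<Longrightarrow> \<zeta> (p * n) ^ n = \<zeta> p"
  by (simp add: \<zeta>_power) (simp add: \<zeta>_def)

lemma mu_mult: "x \<in> \<mu> n \<Longrightarrow> y \<in> \<mu> n \<Longrightarrow> x * y \<in> \<mu> n"
  by (simp add: \<mu>_def power_mult_distrib)

lemma mu_power: "x \<in> \<mu> n \<Longrightarrow> x ^ k \<in> \<mu> n"
  by (simp add: \<mu>_def) (metis mult.commute power_mult power_one)

lemma one_in_mu [simp]: "1 \<in> \<mu> n"
  by (simp add: \<mu>_def)

lemma \<zeta>_in_mu [simp]: "n > 0 \<Longrightarrow> \<zeta> n \<in> \<mu> n"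
  by (simp add: \<mu>_def)

lemma mu_mono: "m dvd n \<Longrightarrow> \<mu> m \<subseteq> \<mu> n"
  by (auto simp: \<mu>_def elim!: dvdE simp: power_mult)

lemma mu_eq_power:
  assumes "n > 0" "z \<in> \<mu> n"
  obtains k where "k < n" "z = \<zeta> n ^ k"
proof -
  have "bij_betw (\<lambda>k. cis (2 * pi * real k / real n)) {..<n} {z. z ^ n = 1}"
    using assms(1) by (rule bij_betw_roots_unity)
  hence "(\<lambda>k. \<zeta> n ^ k) ` {..<n} = \<mu> n"
    unfolding \<zeta>_power \<mu>_def by (rule bij_betw_imp_surj_on)
  thus thesis using assms(2) that by blast
qed

lemma power_cong_unity:
  fixes z :: complex
  assumes "z ^ n = 1" "[a = b] (mod n)"
  shows "z ^ a = z ^ b"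
proof -
  have "z ^ a = z ^ (a mod n)" for a
  proof -
    have "z ^ a = (z ^ n) ^ (a div n) * z ^ (a mod n)"
      by (simp flip: power_mult power_add)
    thus ?thesis using assms(1) by simp
  qed
  thus ?thesis using assms(2) by (metis cong_def)
qed

lemma \<zeta>_power_eq_1_iff:
  assumes "n > 0"
  shows "\<zeta> n ^ k = 1 \<longleftrightarrow> n dvd k"
proof
  assume "\<zeta> n ^ k = 1"
  have inj: "inj_on (\<lambda>k. \<zeta> n ^ k) {..<n}"
    using bij_betw_roots_unity[OF assms] unfolding \<zeta>_power by (rule bij_betw_imp_inj_on)
  have "\<zeta> n ^ (k mod n) = \<zeta> n ^ k"
    using assms by (intro power_cong_unity[of _ n]) (auto simp: cong_def)
  hence "\<zeta> n ^ (k mod n) = \<zeta> n ^ 0" using \<open>\<zeta> n ^ k = 1\<close> by simp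
  hence "k mod n = 0" using inj_onD[OF inj] assms by auto
  thus "n dvd k" by auto
next
  assume "n dvd k"
  thus "\<zeta> n ^ k = 1" using assms by (auto elim!: dvdE simp: power_mult)
qed

lemma zero_in_cyclo: "0 \<in> cyclo n"
  unfolding cyclo_def by (auto intro!: exI[of _ "{#}"])

lemma sum_mset_in_cyclo: "set_mset A \<subseteq> \<mu> n \<Longrightarrow> \<Sum>\<^sub># A \<in> cyclo n"
  unfolding cyclo_def by (intro CollectI exI[of _ A] exI[of _ "{#}"]) simp

lemma mu_subset_cyclo: "\<mu> n \<subseteq> cyclo n"
  using sum_mset_in_cyclo[of "{#u#}" n for u] by auto

lemma cyclo_uminus: "x \<in> cyclo n \<Longrightarrow> - x \<in> cyclo n"
  unfolding cyclo_def by fastforce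

lemma cyclo_add:
  assumes "x \<in> cyclo n" "y \<in> cyclo n"
  shows "x + y \<in> cyclo n"
proof -
  obtain A B C D where "x = \<Sum>\<^sub># A - \<Sum>\<^sub># B" "y = \<Sum>\<^sub># C - \<Sum>\<^sub># D"
    "set_mset A \<subseteq> \<mu> n" "set_mset B \<subseteq> \<mu> n" "set_mset C \<subseteq> \<mu> n" "set_mset D \<subseteq> \<mu> n"
    using assms unfolding cyclo_def by blast
  thus ?thesis unfolding cyclo_def
    by (intro CollectI exI[of _ "A + C"] exI[of _ "B + D"]) auto
qed

lemma cyclo_diff: "x \<in> cyclo n \<Longrightarrow> y \<in> cyclo n \<Longrightarrow> x - y \<in> cyclo n"
  using cyclo_add[of x n "- y"] cyclo_uminus by simp

lemma sum_mset_scale: "\<Sum>\<^sub># (image_mset ((*) u) C) = u * \<Sum>\<^sub># C" for u :: complex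
  by (induction C) (simp_all add: distrib_left)

lemma cyclo_scale:
  assumes "x \<in> cyclo n" "u \<in> \<mu> n"
  shows "u * x \<in> cyclo n"
proof -
  obtain A B where "x = \<Sum>\<^sub># A - \<Sum>\<^sub># B" "set_mset A \<subseteq> \<mu> n" "set_mset B \<subseteq> \<mu> n"
    using assms unfolding cyclo_def by blast
  thus ?thesis unfolding cyclo_def using assms(2)
    by (intro CollectI exI[of _ "image_mset ((*) u) A"] exI[of _ "image_mset ((*) u) B"])
       (auto simp: mu_mult right_diff_distrib sum_mset_scale)
qed

lemma cyclo_mult:
  assumes "x \<in> cyclo n" "y \<in> cyclo n"
  shows "x * y \<in> cyclo n"
proof -
  have *: "\<Sum>\<^sub># A * y \<in> cyclo n" if "set_mset A \<subseteq> \<mu> n" for A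
    using that by (induction A) (auto simp: zero_in_cyclo distrib_right intro!: cyclo_add cyclo_scale assms)
  obtain A B where "x = \<Sum>\<^sub># A - \<Sum>\<^sub># B" "set_mset A \<subseteq> \<mu> n" "set_mset B \<subseteq> \<mu> n"
    using assms unfolding cyclo_def by blast
  thus ?thesis using * by (simp add: left_diff_distrib cyclo_diff)
qed

lemma cyclo_mono: "m dvd n \<Longrightarrow> cyclo m \<subseteq> cyclo n"
  unfolding cyclo_def using mu_mono[of m n] by blast

lemma cyclo_eq_ev:
  assumes "n > 0" "x \<in> cyclo n"
  obtains p where "x = ev p (\<zeta> n)"
proof -
  have *: "\<exists>p. \<Sum>\<^sub># A = ev p (\<zeta> n)" if "set_mset A \<subseteq> \<mu> n" for A
    using that
  proof (induction A)
    case empty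
    show ?case by (intro exI[of _ 0]) simp
  next
    case (add u A)
    then obtain p where "\<Sum>\<^sub># A = ev p (\<zeta> n)" by auto
    moreover obtain k where "u = \<zeta> n ^ k" using mu_eq_power[OF assms(1), of u] add.prems by auto
    ultimately show ?case by (intro exI[of _ "monom 1 k + p"]) simp
  qed
  obtain A B where "x = \<Sum>\<^sub># A - \<Sum>\<^sub># B" "set_mset A \<subseteq> \<mu> n" "set_mset B \<subseteq> \<mu> n"
    using assms unfolding cyclo_def by blast
  then obtain p q where "x = ev (p - q) (\<zeta> n)" using * by (metis ev_diff)
  thus thesis by (rule that)
qed

section \<open>Relations over a subring of cyclotomic integers\<close>

text \<open>
  Conjugations by \<open>k \<equiv> 1 (mod n)\<close> fix the coefficients, which lie in \<open>\<int>[\<mu>\<^sub>n]\<close>, and so act on the powers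
  of the root of order \<open>p * n\<close> only.
\<close>
lemma conjugate_relation:
  assumes "n > 0" "p > 0" and x: "\<And>i. i < p \<Longrightarrow> x i \<in> cyclo n"
    and rel: "(\<Sum>i<p. \<zeta> (p * n) ^ (e * i) * x i) = 0"
    and k: "k > 0" "coprime k (p * n)" "[k = 1] (mod n)"
  shows "(\<Sum>i<p. \<zeta> (p * n) ^ (e * i * k) * x i) = 0"
proof -
  have "\<exists>q. x i = ev q (\<zeta> n)" if "i < p" for i
    using cyclo_eq_ev[OF assms(1) x[OF that]] by blast
  then obtain X where X: "\<And>i. i < p \<Longrightarrow> x i = ev (X i) (\<zeta> n)" by metis
  define G where "G = (\<Sum>i<p. monom 1 (e * i) * pcompose (X i) (monom 1 p))"
  have G: "ev G z = (\<Sum>i<p. z ^ (e * i) * ev (X i) (z ^ p))" for z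
    by (simp add: G_def ev_sum ev_pcompose)
  have "ev G (\<zeta> (p * n)) = 0"
    using rel assms(2) by (simp add: G X \<zeta>_mult_power)
  hence 0: "ev G (\<zeta> (p * n) ^ k) = 0"
    using assms by (intro conjugate[of "p * n"]) auto
  have "(\<zeta> (p * n) ^ k) ^ p = \<zeta> n ^ k"
    using assms(2) \<zeta>_mult_power by (metis mult.commute power_mult)
  also have "\<dots> = \<zeta> n" using power_cong_unity[OF _ k(3), of "\<zeta> n"] assms(1) by simp
  finally show ?thesis using 0 by (simp add: G X power_mult[symmetric] mult_ac)
qed

text \<open>
  By Fourier inversion modulo \<open>p\<close>: only the trivial Fourier coefficient of \<open>y\<close>, which is its sum,
  contributes to the value at \<open>j\<close>.
\<close>
lemma fourier_inversion:
  assumes p: "p > 0" and j: "j < p"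
    and 0: "\<And>t. 0 < t \<Longrightarrow> t < p \<Longrightarrow> (\<Sum>i<p. \<zeta> p ^ (t * i) * y i) = 0"
  shows "of_nat p * y j = (\<Sum>i<p. y i)"
proof -
  \<comment> \<open>The exponent \<open>p - j\<close> stands for \<open>- j\<close>.\<close>
  have geo: "(\<Sum>t<p. (\<zeta> p ^ (p - j + i)) ^ t) = (if i = j then of_nat p else 0)" if i: "i < p" for i
  proof (cases "i = j")
    case True
    thus ?thesis using p j by simp
  next
    case False
    have "\<not> p dvd p - j + i"
    proof
      assume "p dvd p - j + i"
      then obtain c where c: "p - j + i = p * c" by (auto elim: dvdE)
      have "p * c < p * 2" "0 < p * c" using c i j by linarith+
      hence "c = 1" by simp
      thus False using c i j False by simp
    qed
    hence "\<zeta> p ^ (p - j + i) \<noteq> 1" using p by (simp add: \<zeta>_power_eq_1_iff)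
    moreover have "(\<zeta> p ^ (p - j + i)) ^ p = 1"
      using p by (metis \<zeta>_power_self mult.commute power_mult power_one)
    ultimately show ?thesis using False by (simp add: geometric_sum)
  qed
  have "(\<Sum>i<p. y i) = (\<Sum>t<p. \<zeta> p ^ (t * (p - j)) * (\<Sum>i<p. \<zeta> p ^ (t * i) * y i))"
  proof -
    have "(\<Sum>t<p. \<zeta> p ^ (t * (p - j)) * (\<Sum>i<p. \<zeta> p ^ (t * i) * y i))
        = (\<Sum>t<p. if t = 0 then \<Sum>i<p. y i else 0)"
      using 0 by (intro sum.cong) auto
    thus ?thesis using p by simp
  qed
  also have "\<dots> = (\<Sum>t<p. \<Sum>i<p. y i * (\<zeta> p ^ (p - j + i)) ^ t)"
    unfolding sum_distrib_left
    by (intro sum.cong refl) (simp add: power_mult[symmetric] power_add[symmetric] algebra_simps)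
  also have "\<dots> = (\<Sum>i<p. y i * (\<Sum>t<p. (\<zeta> p ^ (p - j + i)) ^ t))"
    unfolding sum_distrib_left by (rule sum.swap)
  also have "\<dots> = (\<Sum>i<p. if i = j then y i * of_nat p else 0)"
    by (intro sum.cong refl) (simp add: geo)
  also have "\<dots> = of_nat p * y j" using j by (simp add: mult.commute)
  finally show ?thesis by simp
qed

text \<open>
  For \<open>p\<close> prime to \<open>n\<close> the only relation over \<open>\<int>[\<mu>\<^sub>n]\<close> between the \<open>p\<close>-th roots of unity is that they sum
  to zero: conjugating by \<open>k \<equiv> 1 (mod n)\<close>, \<open>k \<equiv> t (mod p)\<close> shows that all nontrivial Fourier
  coefficients of \<open>x\<close> vanish.
\<close>
lemma unramified_relation:
  assumes "prime p" "n > 0" "\<not> p dvd n" and x: "\<And>i. i < p \<Longrightarrow> x i \<in> cyclo n"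
    and rel: "(\<Sum>i<p. \<zeta> p ^ i * x i) = 0"
    and "i < p" "j < p"
  shows "x i = x j"
proof -
  have p: "p > 0" using assms(1) by (rule prime_gt_0_nat)
  have "(\<Sum>i<p. \<zeta> p ^ (t * i) * x i) = 0" if t: "0 < t" "t < p" for t
  proof -
    have cop: "coprime n p" using assms by (metis coprime_commute prime_imp_coprime)
    then obtain k where k: "[k = 1] (mod n)" "[k = t] (mod p)"
      using binary_chinese_remainder_nat by blast
    have "\<not> p dvd t" using t by (simp add: nat_dvd_not_less)
    hence "\<not> p dvd k" using k(2) cong_dvd_iff by blast
    hence "coprime k p" using assms(1) by (metis coprime_commute prime_imp_coprime)
    moreover have "coprime k n" using k(1) by (metis cong_imp_coprime cong_sym coprime_1_left)
    moreover have "k > 0" using \<open>\<not> p dvd k\<close> by (cases k) auto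
    ultimately have "(\<Sum>i<p. \<zeta> (p * n) ^ (n * i * k) * x i) = 0"
      using rel k p assms(2) x
      by (intro conjugate_relation) (auto simp: power_mult \<zeta>_mult_power')
    moreover have "\<zeta> (p * n) ^ (n * i * k) = \<zeta> p ^ (t * i)" for i
    proof -
      have "\<zeta> (p * n) ^ (n * i * k) = \<zeta> p ^ (k * i)"
        using assms(2) \<zeta>_mult_power'[of n p] by (metis mult.assoc mult.commute power_mult)
      also have "\<dots> = \<zeta> p ^ (t * i)"
        using k(2) p by (intro power_cong_unity[of _ p] cong_scalar_right) auto
      finally show ?thesis .
    qed
    ultimately show ?thesis by simp
  qed
  hence "of_nat p * x j = (\<Sum>i<p. x i)" if "j < p" for j
    using that p by (intro fourier_inversion) auto
  hence "of_nat p * x i = of_nat p * x j" using assms by simp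
  thus ?thesis using p by simp
qed

text \<open>
  If \<open>p\<close> divides \<open>n\<close>, then every \<open>k = 1 + n * t\<close> is a unit modulo \<open>p * n\<close>, so even the trivial Fourier
  coefficient vanishes: the powers \<open>\<zeta>\<^sub>p\<^sub>n\<^sup>i\<close>, \<open>i < p\<close>, are linearly independent over \<open>\<int>[\<mu>\<^sub>n]\<close>.
\<close>
lemma ramified_relation:
  assumes "prime p" "n > 0" "p dvd n" and x: "\<And>i. i < p \<Longrightarrow> x i \<in> cyclo n"
    and rel: "(\<Sum>i<p. \<zeta> (p * n) ^ i * x i) = 0"
    and "j < p"
  shows "x j = 0"
proof -
  have p: "p > 0" using assms(1) by (rule prime_gt_0_nat)
  have "(\<Sum>i<p. \<zeta> p ^ (t * i) * (\<zeta> (p * n) ^ i * x i)) = 0" for t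
  proof -
    define k where "k = 1 + n * t"
    have "[k = 1] (mod n)" unfolding k_def cong_def by (metis mod_mult_self2)
    moreover from this have "coprime k n" by (metis cong_imp_coprime cong_sym coprime_1_left)
    moreover from this have "coprime k p" using assms(3) by (metis coprime_divisors dvd_refl)
    moreover have "k > 0" by (simp add: k_def)
    ultimately have "(\<Sum>i<p. \<zeta> (p * n) ^ (1 * i * k) * x i) = 0"
      using rel p assms(2) x by (intro conjugate_relation) auto
    moreover have "\<zeta> (p * n) ^ (1 * i * k) = \<zeta> p ^ (t * i) * \<zeta> (p * n) ^ i" for i
    proof -
      have "\<zeta> (p * n) ^ (1 * i * k) = (\<zeta> (p * n) ^ n) ^ (t * i) * \<zeta> (p * n) ^ i"
        by (simp add: k_def algebra_simps flip: power_mult power_add)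
      thus ?thesis using assms(2) by (simp add: \<zeta>_mult_power')
    qed
    ultimately show ?thesis by (simp add: mult.assoc)
  qed
  hence "of_nat p * (\<zeta> (p * n) ^ j * x j) = (\<Sum>i<p. \<zeta> (p * n) ^ i * x i)"
    using assms p by (intro fourier_inversion) auto
  thus ?thesis using p rel by simp
qed

section \<open>Congruence modulo two\<close>

lemma cong2_refl [simp]: "cong2 n x x"
  unfolding cong2_def using zero_in_cyclo by force

lemma cong2_sym: "cong2 n x y \<Longrightarrow> cong2 n y x"
  unfolding cong2_def using cyclo_uminus by (metis minus_diff_eq mult_minus_right)

lemma cong2_trans:
  assumes "cong2 n x y" "cong2 n y z"
  shows "cong2 n x z"
proof -
  obtain r s where "r \<in> cyclo n" "s \<in> cyclo n" "x - y = 2 * r" "y - z = 2 * s"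
    using assms unfolding cong2_def by blast
  thus ?thesis unfolding cong2_def
    by (intro bexI[of _ "r + s"]) (auto simp: cyclo_add algebra_simps)
qed

lemma cong2_add:
  assumes "cong2 n x y" "cong2 n x' y'"
  shows "cong2 n (x + x') (y + y')"
proof -
  obtain r s where "r \<in> cyclo n" "s \<in> cyclo n" "x - y = 2 * r" "x' - y' = 2 * s"
    using assms unfolding cong2_def by blast
  thus ?thesis unfolding cong2_def
    by (intro bexI[of _ "r + s"]) (auto simp: cyclo_add algebra_simps)
qed

lemma cong2_mult:
  assumes "cong2 n x y" "c \<in> cyclo n"
  shows "cong2 n (c * x) (c * y)"
proof -
  obtain r where "r \<in> cyclo n" "x - y = 2 * r"
    using assms unfolding cong2_def by blast
  thus ?thesis unfolding cong2_def
    by (intro bexI[of _ "c * r"]) (auto simp: cyclo_mult assms algebra_simps simp flip: right_diff_distrib)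
qed

lemma cong2_uminus:
  assumes "x \<in> cyclo n" shows "cong2 n (- x) x"
  unfolding cong2_def using assms by (intro bexI[of _ "- x"]) (auto simp: cyclo_uminus)

lemma cong2_mono: "m dvd n \<Longrightarrow> cong2 m x y \<Longrightarrow> cong2 n x y"
  unfolding cong2_def using cyclo_mono by blast

section \<open>Splitting off a prime from the order\<close>

text \<open>
  \<open>\<mu>\<^sub>p\<^sub>n\<close> is the product of \<open>\<mu>\<^sub>p\<close> and \<open>\<mu>\<^sub>n\<close>; the factor in \<open>\<mu>\<^sub>p\<close> is \<open>z\<^sup>e\<close> for the idempotent \<open>e\<close> given by the
  Chinese remainder theorem.
\<close>
lemma mu_decompose_unramified:
  assumes "prime p" "n > 0" "\<not> p dvd n" "z \<in> \<mu> (p * n)"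
  obtains i u where "i < p" "u \<in> \<mu> n" "z = \<zeta> p ^ i * u"
proof -
  have p: "p > 0" using assms(1) by (rule prime_gt_0_nat)
  have cop: "coprime n p" using assms by (metis coprime_commute prime_imp_coprime)
  then obtain e where e: "[e = 0] (mod n)" "[e = 1] (mod p)"
    using binary_chinese_remainder_nat by blast
  have z: "z ^ (p * n) = 1" "z \<noteq> 0" using assms p by (auto simp: \<mu>_def power_0_left)
  have "[e * p = 0 * p] (mod n * p)" using e(1) by (simp add: cong_0_iff)
  hence "z ^ (e * p) = z ^ (0 * p)" using z(1) by (intro power_cong_unity[of z "p * n"]) (auto simp: mult.commute)
  hence "z ^ e \<in> \<mu> p" by (simp add: \<mu>_def power_mult)
  then obtain i where i: "i < p" "z ^ e = \<zeta> p ^ i" using mu_eq_power[OF p] by metis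
  have "[e * n = 1 * n] (mod p * n)" using e(2) by (simp add: cong_def)
  hence "z ^ (e * n) = z ^ (1 * n)" using z(1) by (intro power_cong_unity[of z "p * n"]) auto
  hence "z / z ^ e \<in> \<mu> n" using z(2) by (simp add: \<mu>_def power_divide power_mult)
  moreover have "z = \<zeta> p ^ i * (z / z ^ e)" using z(2) by (simp flip: i(2))
  ultimately show thesis using that i(1) by blast
qed

lemma mu_decompose_ramified:
  assumes "p > 0" "n > 0" "z \<in> \<mu> (p * n)"
  obtains i u where "i < p" "u \<in> \<mu> n" "z = \<zeta> (p * n) ^ i * u"
proof -
  obtain k where "z = \<zeta> (p * n) ^ k" using mu_eq_power assms by (metis nat_0_less_mult_iff)
  also have "\<dots> = \<zeta> (p * n) ^ (k mod p) * (\<zeta> (p * n) ^ p) ^ (k div p)"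
    by (simp flip: power_mult power_add)
  also have "\<zeta> (p * n) ^ p = \<zeta> n" using assms(1) by (rule \<zeta>_mult_power)
  finally show thesis using that assms by (metis mod_less_divisor mu_power \<zeta>_in_mu)
qed

text \<open>
  The multiset union of the translates \<open>w\<^sup>i * T i\<close> for \<open>i < p\<close>. Every relation is taken apart in this
  way, with \<open>w\<close> a root of unity and parts \<open>T i\<close> of smaller order.
\<close>
definition glue :: "nat \<Rightarrow> complex \<Rightarrow> (nat \<Rightarrow> complex multiset) \<Rightarrow> complex multiset" where
  "glue p w T = (\<Sum>i<p. image_mset ((*) (w ^ i)) (T i))"

lemma decompose_mset:
  assumes D: "\<And>z. z \<in> V \<Longrightarrow> \<exists>i<p. \<exists>u\<in>\<mu> n. z = w ^ i * u" and S: "set_mset S \<subseteq> V"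
  shows "\<exists>T. S = glue p w T \<and> (\<forall>i. set_mset (T i) \<subseteq> \<mu> n)"
  using S
proof (induction S)
  case empty
  show ?case by (intro exI[of _ "\<lambda>_. {#}"]) (simp add: glue_def)
next
  case (add z S)
  then obtain T where T: "S = glue p w T" "\<And>i. set_mset (T i) \<subseteq> \<mu> n" by auto
  obtain i u where i: "i < p" "u \<in> \<mu> n" "z = w ^ i * u" using D[of z] add.prems by auto
  have "glue p w (T(i := add_mset u (T i))) = add_mset z (glue p w T)"
    unfolding glue_def using i by (simp add: sum.remove[of "{..<p}" i])
  thus ?case using T i by (intro exI[of _ "T(i := add_mset u (T i))"]) (auto simp del: fun_upd_apply, auto split: if_splits)
qed

lemma size_glue: "size (glue p w T) = (\<Sum>i<p. size (T i))"
  unfolding glue_def by (induction p) auto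

lemma sum_glue: "\<Sum>\<^sub># (glue p w T) = (\<Sum>i<p. w ^ i * \<Sum>\<^sub># (T i))"
  unfolding glue_def by (induction p) (auto simp: sum_mset_scale)

lemma cyclo_decompose:
  assumes D: "\<And>z. z \<in> \<mu> N \<Longrightarrow> \<exists>i<p. \<exists>u\<in>\<mu> n. z = w ^ i * u" and "r \<in> cyclo N"
  obtains r' where "\<And>i. r' i \<in> cyclo n" "r = (\<Sum>i<p. w ^ i * r' i)"
proof -
  obtain A B where AB: "r = \<Sum>\<^sub># A - \<Sum>\<^sub># B" "set_mset A \<subseteq> \<mu> N" "set_mset B \<subseteq> \<mu> N"
    using assms(2) unfolding cyclo_def by blast
  obtain TA where TA: "A = glue p w TA" "\<And>i. set_mset (TA i) \<subseteq> \<mu> n"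
    using decompose_mset[OF D AB(2)] by auto
  obtain TB where TB: "B = glue p w TB" "\<And>i. set_mset (TB i) \<subseteq> \<mu> n"
    using decompose_mset[OF D AB(3)] by auto
  show thesis
  proof (rule that)
    show "\<Sum>\<^sub># (TA i) - \<Sum>\<^sub># (TB i) \<in> cyclo n" for i
      using TA TB by (intro cyclo_diff sum_mset_in_cyclo) auto
    show "r = (\<Sum>i<p. w ^ i * (\<Sum>\<^sub># (TA i) - \<Sum>\<^sub># (TB i)))"
      by (simp add: AB TA TB sum_glue right_diff_distrib sum_subtractf)
  qed
qed

text \<open>
  The ring element witnessing divisibility by \<open>2\<close> is itself
  decomposed along the powers of \<open>\<zeta>\<^sub>p\<close>, which turns the congruence into a relation over \<open>\<int>[\<mu>\<^sub>n]\<close> that holds exactly.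
\<close>
lemma cong2_unramified:
  assumes "prime p" "n > 0" "\<not> p dvd n" and x: "\<And>i. i < p \<Longrightarrow> x i \<in> cyclo n"
    and rel: "cong2 (p * n) (\<Sum>i<p. \<zeta> p ^ i * x i) 0" and "i < p" "j < p"
  shows "cong2 n (x i) (x j)"
proof -
  obtain r where r: "r \<in> cyclo (p * n)" "(\<Sum>i<p. \<zeta> p ^ i * x i) = 2 * r"
    using rel by (auto simp: cong2_def)
  have D: "\<exists>i<p. \<exists>u\<in>\<mu> n. z = \<zeta> p ^ i * u" if "z \<in> \<mu> (p * n)" for z
    using mu_decompose_unramified[OF assms(1-3) that] by metis
  obtain r' where r': "\<And>i. r' i \<in> cyclo n" "r = (\<Sum>i<p. \<zeta> p ^ i * r' i)"
    using cyclo_decompose[OF D r(1)] by metis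
  have "(\<Sum>i<p. \<zeta> p ^ i * (x i - (r' i + r' i))) = 0"
    using r(2) by (simp add: r'(2) right_diff_distrib distrib_left sum_subtractf sum.distrib)
      (simp add: sum_distrib_left mult.left_commute[of _ 2])
  moreover have "x i - (r' i + r' i) \<in> cyclo n" if "i < p" for i
    using that x r' by (intro cyclo_diff cyclo_add)
  ultimately have "x i - (r' i + r' i) = x j - (r' j + r' j)"
    using assms by (intro unramified_relation[of p n "\<lambda>i. x i - (r' i + r' i)"])
  thus ?thesis
    unfolding cong2_def using r'(1)
    by (intro bexI[of _ "r' i - r' j"] cyclo_diff) (auto simp: algebra_simps)
qed

lemma cong2_ramified:
  assumes "prime p" "n > 0" "p dvd n" and x: "\<And>i. i < p \<Longrightarrow> x i \<in> cyclo n"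
    and rel: "cong2 (p * n) (\<Sum>i<p. \<zeta> (p * n) ^ i * x i) 0" and "i < p"
  shows "cong2 n (x i) 0"
proof -
  obtain r where r: "r \<in> cyclo (p * n)" "(\<Sum>i<p. \<zeta> (p * n) ^ i * x i) = 2 * r"
    using rel by (auto simp: cong2_def)
  have D: "\<exists>i<p. \<exists>u\<in>\<mu> n. z = \<zeta> (p * n) ^ i * u" if "z \<in> \<mu> (p * n)" for z
    using mu_decompose_ramified[OF prime_gt_0_nat[OF assms(1)] assms(2) that] by metis
  obtain r' where r': "\<And>i. r' i \<in> cyclo n" "r = (\<Sum>i<p. \<zeta> (p * n) ^ i * r' i)"
    using cyclo_decompose[OF D r(1)] by metis
  have "(\<Sum>i<p. \<zeta> (p * n) ^ i * (x i - (r' i + r' i))) = 0"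
    using r(2) by (simp add: r'(2) right_diff_distrib distrib_left sum_subtractf sum.distrib)
      (simp add: sum_distrib_left mult.left_commute[of _ 2])
  moreover have "x i - (r' i + r' i) \<in> cyclo n" if "i < p" for i
    using that x r' by (intro cyclo_diff cyclo_add)
  ultimately have "x i - (r' i + r' i) = 0"
    using assms by (intro ramified_relation[of p n "\<lambda>i. x i - (r' i + r' i)"])
  thus ?thesis
    unfolding cong2_def using r'(1) by (intro bexI[of _ "r' i"]) auto
qed

section \<open>Sums with signs\<close>

text \<open>
  The value \<open>s\<close> is obtained from \<open>S\<close> by some choice of signs: the elements of \<open>A\<close> are taken with a plus sign
  and those of \<open>B\<close> with a minus sign. No enumeration of \<open>S\<close> is involved, so equal elements may
  receive different signs.
\<close>
definition signed_sum :: "complex multiset \<Rightarrow> complex \<Rightarrow> bool" where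
  "signed_sum S s \<longleftrightarrow> (\<exists>A B. S = A + B \<and> s = \<Sum>\<^sub># A - \<Sum>\<^sub># B)"

lemma signed_sum_empty [simp]: "signed_sum {#} s \<longleftrightarrow> s = 0"
  by (auto simp: signed_sum_def)

lemma signed_sum_uminus: "signed_sum S s \<Longrightarrow> signed_sum S (- s)"
  unfolding signed_sum_def by (metis add.commute minus_diff_eq)

lemma signed_sum_add:
  assumes "signed_sum A a" "signed_sum B b"
  shows "signed_sum (A + B) (a + b)"
proof -
  obtain A1 A2 B1 B2 where "A = A1 + A2" "a = \<Sum>\<^sub># A1 - \<Sum>\<^sub># A2" "B = B1 + B2" "b = \<Sum>\<^sub># B1 - \<Sum>\<^sub># B2"
    using assms unfolding signed_sum_def by blast
  thus ?thesis unfolding signed_sum_def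
    by (intro exI[of _ "A1 + B1"] exI[of _ "A2 + B2"]) (auto simp: algebra_simps)
qed

lemma signed_sum_scale:
  assumes "signed_sum S s"
  shows "signed_sum (image_mset ((*) c) S) (c * s)"
proof -
  obtain A B where "S = A + B" "s = \<Sum>\<^sub># A - \<Sum>\<^sub># B" using assms unfolding signed_sum_def by blast
  thus ?thesis unfolding signed_sum_def
    by (intro exI[of _ "image_mset ((*) c) A"] exI[of _ "image_mset ((*) c) B"])
       (auto simp: sum_mset_scale right_diff_distrib)
qed

lemma signed_sum_single: "signed_sum {#u#} u"
  unfolding signed_sum_def by (intro exI[of _ "{#u#}"] exI[of _ "{#}"]) simp

lemma signed_sum_add_mset:
  assumes "signed_sum S s"
  shows "signed_sum (add_mset u S) (s + u)" "signed_sum (add_mset u S) (s - u)"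
  using signed_sum_add[OF assms signed_sum_single[of u]]
    signed_sum_add[OF assms signed_sum_uminus[OF signed_sum_single[of u]]] by auto

lemma signed_sum_add_mset_cases:
  assumes "signed_sum (add_mset u S) s"
  obtains s' where "signed_sum S s'" "s = s' + u \<or> s = s' - u"
proof -
  obtain A B where AB: "add_mset u S = A + B" "s = \<Sum>\<^sub># A - \<Sum>\<^sub># B"
    using assms unfolding signed_sum_def by blast
  have "u \<in># A + B" by (simp flip: AB(1))
  then consider A' where "A = add_mset u A'" | B' where "B = add_mset u B'"
    by (metis union_iff mset_add)
  thus thesis
  proof cases
    case 1
    hence "S = A' + B" "s = (\<Sum>\<^sub># A' - \<Sum>\<^sub># B) + u" using AB by simp_all
    thus thesis using that unfolding signed_sum_def by blast
  next
    case 2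
    hence "S = A + B'" "s = (\<Sum>\<^sub># A - \<Sum>\<^sub># B') - u" using AB by simp_all
    thus thesis using that unfolding signed_sum_def by blast
  qed
qed

text \<open>
  This removes a single factor \<open>2\<close> from the order: one of \<open>u\<close> and \<open>- u\<close> then has odd order, and it does not
  matter which of the two occurs.
\<close>
lemma signed_sum_flip:
  assumes "signed_sum (A + B) s"
  shows "signed_sum (A + image_mset ((*) (-1)) B) s"
  using assms
proof (induction B arbitrary: A)
  case (add u B)
  obtain s' where s': "signed_sum (A + B) s'" "s = s' + u \<or> s = s' - u"
    using signed_sum_add_mset_cases[of u "A + B" s] add.prems by auto
  hence "signed_sum (add_mset (- u) (A + B)) s"
    using signed_sum_add_mset[OF s'(1), of "- u"] by auto
  hence "signed_sum (add_mset (- u) A + B) s" by simp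
  from add.IH[OF this] show ?case by simp
qed simp

lemma signed_sum_cancel:
  assumes "signed_sum (add_mset u S) 0"
  shows "signed_sum S u"
  using assms
proof (rule signed_sum_add_mset_cases)
  fix s' assume "signed_sum S s'" "0 = s' + u \<or> 0 = s' - u"
  hence "s' = - u \<or> s' = u" by (auto simp: eq_neg_iff_add_eq_0)
  thus "signed_sum S u" using \<open>signed_sum S s'\<close> signed_sum_uminus[of S "- u"] by auto
qed

lemma signed_sum_glue:
  assumes "\<And>i. i < p \<Longrightarrow> signed_sum (T i) (s i)"
  shows "signed_sum (glue p w T) (\<Sum>i<p. w ^ i * s i)"
  unfolding glue_def using assms by (induction p) (auto intro!: signed_sum_add signed_sum_scale)

lemma sum_\<zeta>_powers:
  assumes "p > 1"
  shows "(\<Sum>i<p. \<zeta> p ^ i) = 0"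
proof -
  have "\<zeta> p ^ 1 \<noteq> 1" using assms by (subst \<zeta>_power_eq_1_iff) auto
  thus ?thesis using assms by (simp add: geometric_sum)
qed

text \<open>
  If all parts can be signed to the same value \<open>v\<close>, then the total is \<open>v\<close> times the sum of all \<open>p\<close>-th
  roots of unity, hence zero. This is how relations are lifted whenever \<open>p\<close> does not divide \<open>n\<close>.
\<close>
lemma signed_sum_glue_const:
  assumes "p > 1" "\<And>i. i < p \<Longrightarrow> signed_sum (T i) v"
  shows "signed_sum (glue p (\<zeta> p) T) 0"
proof -
  have "signed_sum (glue p (\<zeta> p) T) (\<Sum>i<p. \<zeta> p ^ i * v)" using assms(2) by (rule signed_sum_glue)
  thus ?thesis using sum_\<zeta>_powers[OF assms(1)] by (simp flip: sum_distrib_right)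
qed

section \<open>Removing a prime from the order of a relation\<close>

text \<open>
  The assertion to be proved, for roots of unity of order dividing \<open>n\<close> and weight at most \<open>k\<close>.
\<close>
definition liftable :: "nat \<Rightarrow> nat \<Rightarrow> bool" where
  "liftable n k \<longleftrightarrow> (\<forall>S. set_mset S \<subseteq> \<mu> n \<longrightarrow> size S \<le> k \<longrightarrow> cong2 n (\<Sum>\<^sub># S) 0 \<longrightarrow> signed_sum S 0)"

lemma liftableD:
  "liftable n k \<Longrightarrow> set_mset S \<subseteq> \<mu> n \<Longrightarrow> size S \<le> k \<Longrightarrow> cong2 n (\<Sum>\<^sub># S) 0 \<Longrightarrow> signed_sum S 0"
  by (simp add: liftable_def)

lemma cong2_double: "x \<in> cyclo n \<Longrightarrow> cong2 n (x + x) 0"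
  unfolding cong2_def by (intro bexI[of _ x]) auto

text \<open>
  Adding \<open>u\<close> to \<open>T\<close> gives a relation. In a lift of it, the sign of \<open>u\<close> can be made negative.
\<close>
lemma liftable_target:
  assumes "liftable n k" "set_mset T \<subseteq> \<mu> n" "size T < k" "u \<in> \<mu> n" "cong2 n (\<Sum>\<^sub># T) u"
  shows "signed_sum T u"
proof (rule signed_sum_cancel)
  have "cong2 n (u + \<Sum>\<^sub># T) (u + u)" using assms(5) by (intro cong2_add) auto
  moreover have "cong2 n (u + u) 0" using assms(4) mu_subset_cyclo by (blast intro: cong2_double)
  ultimately have "cong2 n (u + \<Sum>\<^sub># T) 0" by (rule cong2_trans)
  hence "cong2 n (\<Sum>\<^sub># (add_mset u T)) 0" by simp
  thus "signed_sum (add_mset u T) 0"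
    using assms by (intro liftableD[OF assms(1)]) auto
qed

lemma decompose_unramified:
  assumes "prime p" "n > 0" "\<not> p dvd n" "set_mset S \<subseteq> \<mu> (p * n)"
  obtains T where "S = glue p (\<zeta> p) T" "\<And>i. set_mset (T i) \<subseteq> \<mu> n"
    "\<And>i j. cong2 (p * n) (\<Sum>\<^sub># S) 0 \<Longrightarrow> i < p \<Longrightarrow> j < p \<Longrightarrow> cong2 n (\<Sum>\<^sub># (T i)) (\<Sum>\<^sub># (T j))"
proof -
  have D: "\<exists>i<p. \<exists>u\<in>\<mu> n. z = \<zeta> p ^ i * u" if "z \<in> \<mu> (p * n)" for z
    using mu_decompose_unramified[OF assms(1-3) that] by metis
  obtain T where T: "S = glue p (\<zeta> p) T" "\<And>i. set_mset (T i) \<subseteq> \<mu> n"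
    using decompose_mset[OF D assms(4)] by auto
  have "cong2 n (\<Sum>\<^sub># (T i)) (\<Sum>\<^sub># (T j))" if "cong2 (p * n) (\<Sum>\<^sub># S) 0" "i < p" "j < p" for i j
    using assms that T by (intro cong2_unramified[of p n "\<lambda>i. \<Sum>\<^sub># (T i)"]) (auto simp: sum_glue sum_mset_in_cyclo)
  with T that show thesis by blast
qed

lemma size_part_le: "i < p \<Longrightarrow> size (T i) \<le> size (glue p w T)"
  unfolding size_glue by (rule member_le_sum) auto

text \<open>
  When \<open>p\<close> divides \<open>n\<close>, each part is a relation of its own.
\<close>
lemma liftable_ramified:
  assumes "prime p" "n > 0" "p dvd n" "liftable n k"
  shows "liftable (p * n) k"
  unfolding liftable_def
proof (intro allI impI)
  fix S assume S: "set_mset S \<subseteq> \<mu> (p * n)" "size S \<le> k" "cong2 (p * n) (\<Sum>\<^sub># S) 0"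
  have D: "\<exists>i<p. \<exists>u\<in>\<mu> n. z = \<zeta> (p * n) ^ i * u" if "z \<in> \<mu> (p * n)" for z
    using mu_decompose_ramified[OF prime_gt_0_nat[OF assms(1)] assms(2) that] by metis
  obtain T where T: "S = glue p (\<zeta> (p * n)) T" "\<And>i. set_mset (T i) \<subseteq> \<mu> n"
    using decompose_mset[OF D S(1)] by auto
  have "signed_sum (T i) 0" if i: "i < p" for i
  proof (rule liftableD[OF assms(4)])
    show "cong2 n (\<Sum>\<^sub># (T i)) 0"
      using assms S T i by (intro cong2_ramified[of p n "\<lambda>i. \<Sum>\<^sub># (T i)"]) (auto simp: sum_glue sum_mset_in_cyclo)
    show "size (T i) \<le> k" using size_part_le[OF i, of T] S(2) unfolding T(1) by (rule order_trans)
  qed (use T in auto)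
  hence "signed_sum (glue p (\<zeta> (p * n)) T) (\<Sum>i<p. \<zeta> (p * n) ^ i * 0)" by (intro signed_sum_glue)
  thus "signed_sum S 0" by (simp add: T(1))
qed

text \<open>
  For odd \<open>n\<close>, every element of \<open>\<mu>\<^sub>2\<^sub>n\<close> agrees up to sign with an element of \<open>\<mu>\<^sub>n\<close>, and signs are
  irrelevant on both sides of the implication.
\<close>
lemma liftable_double:
  assumes "odd n" "liftable n k"
  shows "liftable (2 * n) k"
  unfolding liftable_def
proof (intro allI impI)
  fix S assume S: "set_mset S \<subseteq> \<mu> (2 * n)" "size S \<le> k" "cong2 (2 * n) (\<Sum>\<^sub># S) 0"
  have "n > 0" using assms(1) by (rule odd_pos)
  then obtain T where T: "S = glue 2 (\<zeta> 2) T" "\<And>i. set_mset (T i) \<subseteq> \<mu> n"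
    "\<And>i j. i < 2 \<Longrightarrow> j < 2 \<Longrightarrow> cong2 n (\<Sum>\<^sub># (T i)) (\<Sum>\<^sub># (T j))"
    using decompose_unramified[OF two_is_prime_nat \<open>n > 0\<close> assms(1) S(1)] S(3) by metis
  have z: "\<zeta> 2 = -1" by (simp add: \<zeta>_def)
  have id: "image_mset ((*) 1) M = M" for M :: "complex multiset" by (induction M) auto
  have S_eq: "S = T 0 + image_mset ((*) (-1)) (T 1)"
    by (simp add: T(1) glue_def lessThan_Suc numeral_2_eq_2 z[unfolded numeral_2_eq_2] id add.commute)
  have "signed_sum (T 0 + T 1) 0"
  proof (rule liftableD[OF assms(2)])
    have "cong2 n (\<Sum>\<^sub># (T 0) + \<Sum>\<^sub># (T 1)) (\<Sum>\<^sub># (T 1) + \<Sum>\<^sub># (T 1))"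
      using T(3) by (intro cong2_add) auto
    thus "cong2 n (\<Sum>\<^sub># (T 0 + T 1)) 0"
      using cong2_double[OF sum_mset_in_cyclo[OF T(2)]] by (auto intro: cong2_trans)
    show "size (T 0 + T 1) \<le> k" using S(2) by (simp add: S_eq)
  qed (use T in auto)
  thus "signed_sum S 0" unfolding S_eq by (rule signed_sum_flip)
qed

text \<open>
  All parts are congruent modulo \<open>2\<close>. If one is empty, all are relations. If one is a single root \<open>u\<close>,
  every other part together with \<open>u\<close> is a relation, of weight not exceeding that of the whole
  since it comes from two different parts; so every part can be signed to \<open>u\<close>.
\<close>
lemma signed_sum_of_small_part:
  assumes "liftable n k" "p > 1" "\<And>i. set_mset (T i) \<subseteq> \<mu> n" "size (glue p (\<zeta> p) T) \<le> k"
    and cong: "\<And>i j. i < p \<Longrightarrow> j < p \<Longrightarrow> cong2 n (\<Sum>\<^sub># (T i)) (\<Sum>\<^sub># (T j))"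
    and i: "i < p" "size (T i) \<le> 1"
  shows "signed_sum (glue p (\<zeta> p) T) 0"
proof (cases "T i = {#}")
  case True
  have "signed_sum (T j) 0" if j: "j < p" for j
  proof (rule liftableD[OF assms(1)])
    show "cong2 n (\<Sum>\<^sub># (T j)) 0" using cong[OF j i(1)] True by simp
    show "size (T j) \<le> k" using size_part_le[OF j] assms(4) by (rule order_trans)
  qed (use assms in auto)
  thus ?thesis using assms(2) by (intro signed_sum_glue_const)
next
  case False
  hence "size (T i) = 1" using i(2) by (cases "size (T i)") auto
  then obtain u where u: "T i = {#u#}" by (blast dest: size_1_singleton_mset)
  have "signed_sum (T j) u" if j: "j < p" for j
  proof (cases "j = i")
    case True
    thus ?thesis by (simp add: u signed_sum_single)
  next
    case False
    show ?thesis
    proof (rule liftable_target[OF assms(1)])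
      have "size (T i) + size (T j) = (\<Sum>l\<in>{i,j}. size (T l))" using False by simp
      also have "\<dots> \<le> (\<Sum>l<p. size (T l))" using i j by (intro sum_mono2) auto
      also have "\<dots> \<le> k" using assms(4) by (simp add: size_glue)
      finally show "size (T j) < k" by (simp add: u)
      show "cong2 n (\<Sum>\<^sub># (T j)) u" using cong[OF j i(1)] u by simp
      show "u \<in> \<mu> n" using assms(3)[of i] u by simp
    qed (use assms in auto)
  qed
  thus ?thesis using assms(2) by (intro signed_sum_glue_const)
qed

text \<open>
  With \<open>p\<close> parts and weight below \<open>2 * p\<close>, some part has at most one element.
\<close>
lemma liftable_large_prime:
  assumes "prime p" "n > 0" "\<not> p dvd n" "k < 2 * p" "liftable n k"
  shows "liftable (p * n) k"
  unfolding liftable_def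
proof (intro allI impI)
  fix S assume S: "set_mset S \<subseteq> \<mu> (p * n)" "size S \<le> k" "cong2 (p * n) (\<Sum>\<^sub># S) 0"
  obtain T where T: "S = glue p (\<zeta> p) T" "\<And>i. set_mset (T i) \<subseteq> \<mu> n"
    "\<And>i j. i < p \<Longrightarrow> j < p \<Longrightarrow> cong2 n (\<Sum>\<^sub># (T i)) (\<Sum>\<^sub># (T j))"
    using decompose_unramified[OF assms(1-3) S(1)] S(3) by metis
  have "\<exists>i<p. size (T i) \<le> 1"
  proof (rule ccontr)
    assume "\<not> (\<exists>i<p. size (T i) \<le> 1)"
    hence "(\<Sum>i<p. 2) \<le> (\<Sum>i<p. size (T i))" by (intro sum_mono) force
    thus False using S(2) assms(4) by (simp add: T(1) size_glue)
  qed
  thus "signed_sum S 0" using signed_sum_of_small_part[OF assms(5)] T S(2) prime_gt_1_nat[OF assms(1)]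
    by metis
qed

section \<open>Cube roots of unity\<close>

lemma third_cube_root:
  assumes "x \<in> \<mu> 3" "y \<in> \<mu> 3" "x \<noteq> y"
  shows "- (x + y) \<in> \<mu> 3"
proof -
  have x3: "x ^ 3 = 1" "y ^ 3 = 1" using assms by (auto simp: \<mu>_def)
  have "(x - y) * (x\<^sup>2 + x * y + y\<^sup>2) = x ^ 3 - y ^ 3"
    by (simp add: eval_nat_numeral algebra_simps)
  hence "x\<^sup>2 + x * y + y\<^sup>2 = 0" using assms(3) x3 by simp
  moreover have "(- (x + y)) ^ 3 = x ^ 3 - (2 * x + y) * (x\<^sup>2 + x * y + y\<^sup>2)"
    by (simp add: eval_nat_numeral algebra_simps)
  ultimately have "(- (x + y)) ^ 3 = 1" using x3 by simp
  thus ?thesis by (simp add: \<mu>_def)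
qed

lemma cyclo_3_eq:
  assumes "r \<in> cyclo 3"
  obtains a b where "r = of_int a + of_int b * \<zeta> 3"
proof -
  have 3: "1 + \<zeta> 3 + \<zeta> 3 ^ 2 = 0" using sum_\<zeta>_powers[of 3] by (simp add: eval_nat_numeral)
  have "\<exists>a b. u = of_int a + of_int b * \<zeta> 3" if u: "u \<in> \<mu> 3" for u
  proof -
    obtain k where k: "k < 3" "u = \<zeta> 3 ^ k" using mu_eq_power[OF _ u] by auto
    consider "k = 0" | "k = 1" | "k = 2" using k(1) by linarith
    thus ?thesis
    proof cases
      case 1 thus ?thesis using k by (intro exI[of _ 1] exI[of _ 0]) simp
    next
      case 2 thus ?thesis using k by (intro exI[of _ 0] exI[of _ 1]) simp
    next
      case 3
      thus ?thesis using k \<open>1 + \<zeta> 3 + \<zeta> 3 ^ 2 = 0\<close>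
        by (intro exI[of _ "-1"] exI[of _ "-1"]) (simp add: add_eq_0_iff)
    qed
  qed
  note cube = this
  have *: "\<exists>a b. \<Sum>\<^sub># A = of_int a + of_int b * \<zeta> 3" if "set_mset A \<subseteq> \<mu> 3" for A
    using that
  proof (induction A)
    case empty
    show ?case by (intro exI[of _ 0]) simp
  next
    case (add u A)
    then obtain a b where "\<Sum>\<^sub># A = of_int a + of_int b * \<zeta> 3" by auto
    moreover obtain c d where "u = of_int c + of_int d * \<zeta> 3" using cube[of u] add.prems by auto
    ultimately show ?case
      by (intro exI[of _ "a + c"] exI[of _ "b + d"]) (simp add: algebra_simps)
  qed
  obtain A B where AB: "r = \<Sum>\<^sub># A - \<Sum>\<^sub># B" "set_mset A \<subseteq> \<mu> 3" "set_mset B \<subseteq> \<mu> 3"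
    using assms unfolding cyclo_def by blast
  obtain a b where ab: "\<Sum>\<^sub># A = of_int a + of_int b * \<zeta> 3" using *[OF AB(2)] by blast
  obtain c d where cd: "\<Sum>\<^sub># B = of_int c + of_int d * \<zeta> 3" using *[OF AB(3)] by blast
  show thesis
    by (rule that[of "a - c" "b - d"]) (simp add: AB(1) ab cd algebra_simps)
qed

text \<open>
  The norm \<open>\<bar>a + b \<zeta>\<^sub>3\<bar>\<^sup>2 = a\<^sup>2 - a * b + b\<^sup>2\<close> is an integer, so it is never \<open>1 / 4\<close>.
\<close>
lemma cube_root_not_even:
  assumes "r \<in> cyclo 3"
  shows "2 * r \<notin> \<mu> 3"
proof
  assume "2 * r \<in> \<mu> 3"
  hence "(2 * r) ^ 3 = 1" unfolding \<mu>_def by blast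
  hence "cmod (2 * r) ^ 3 = 1" by (metis norm_power norm_one)
  hence "cmod (2 * r) = 1" using power_eq_imp_eq_base[of "cmod (2 * r)" 3 1] by simp
  hence r2: "cmod r = 1 / 2" by (simp add: norm_mult)
  hence half: "(cmod r)\<^sup>2 = 1 / 4" unfolding r2 by (simp add: power2_eq_square)
  obtain a b where r: "r = of_int a + of_int b * \<zeta> 3" using cyclo_3_eq[OF assms] .
  have z: "\<zeta> 3 = Complex (- 1 / 2) (sqrt 3 / 2)"
    by (simp add: \<zeta>_def complex_eq_iff cos_120 sin_120)
  have "(cmod r)\<^sup>2 = (of_int a - of_int b / 2)\<^sup>2 + (of_int b * (sqrt 3 / 2))\<^sup>2"
    by (simp add: r z cmod_power2)
  also have "\<dots> = of_int (a * a - a * b + b * b)"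
    by (simp add: power2_eq_square algebra_simps)
  finally have "of_int (4 * (a * a - a * b + b * b)) = (1::real)" using half by simp
  hence "4 * (a * a - a * b + b * b) = 1" by (simp only: of_int_eq_1_iff)
  thus False by presburger
qed

text \<open>
  The difference of two distinct elements among zero and the cube roots of unity is congruent to a cube root
  of unity, which is not divisible by \<open>2\<close>. So these are the Teichmueller representatives of the residue
  ring of \<open>\<int>[\<mu>\<^sub>3]\<close> modulo \<open>2\<close>, the field with four elements.
\<close>
lemma cong2_3_imp_eq:
  assumes "u \<in> insert 0 (\<mu> 3)" "v \<in> insert 0 (\<mu> 3)" "cong2 3 u v"
  shows "u = v"
proof (rule ccontr)
  assume neq: "u \<noteq> v"
  obtain r where r: "r \<in> cyclo 3" "u - v = 2 * r" using assms(3) by (auto simp: cong2_def)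
  consider "u = 0" "v \<in> \<mu> 3" | "v = 0" "u \<in> \<mu> 3" | "u \<in> \<mu> 3" "v \<in> \<mu> 3"
    using assms neq by auto
  thus False
  proof cases
    case 1
    hence "2 * - r \<in> \<mu> 3" using r(2) by (metis diff_0 minus_minus mult_minus_right)
    thus False using cube_root_not_even[OF cyclo_uminus[OF r(1)]] by blast
  next
    case 2
    thus False using cube_root_not_even[OF r(1)] r(2) by simp
  next
    case 3
    have "- (u + v) = 2 * - (r + v)" using r(2) by (simp add: algebra_simps)
    moreover have "- (r + v) \<in> cyclo 3" using 3 r mu_subset_cyclo by (blast intro: cyclo_uminus cyclo_add)
    ultimately show False using cube_root_not_even third_cube_root[OF 3 neq] by metis
  qed
qed

text \<open>
  A multiset of cube roots of unity can be signed to the representative of its own class. Adding one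
  root \<open>x\<close> at a time, the value \<open>x + c\<close> or \<open>x - c\<close> is again such a representative up to sign.
\<close>
lemma reduce_cube_roots:
  assumes "set_mset T \<subseteq> \<mu> 3"
  shows "\<exists>c\<in>insert 0 (\<mu> 3). cong2 3 (\<Sum>\<^sub># T) c \<and> signed_sum T c \<and> (c \<noteq> 0 \<longrightarrow> T \<noteq> {#})"
  using assms
proof (induction T)
  case empty
  show ?case by (intro bexI[of _ 0]) auto
next
  case (add x T)
  then obtain c where c: "c \<in> insert 0 (\<mu> 3)" "cong2 3 (\<Sum>\<^sub># T) c" "signed_sum T c" by auto
  have x: "x \<in> \<mu> 3" using add.prems by simp
  have cong: "cong2 3 (\<Sum>\<^sub># (add_mset x T)) (x + c)" using c(2) by (simp add: cong2_add)
  consider "c = 0" | "c = x" | "c \<in> \<mu> 3" "c \<noteq> x" using c(1) by auto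
  thus ?case
  proof cases
    case 1
    thus ?thesis using x cong signed_sum_add_mset(1)[OF c(3), of x] by (intro bexI[of _ x]) auto
  next
    case 2
    have "cong2 3 (x + c) 0" unfolding 2 using x mu_subset_cyclo by (blast intro: cong2_double)
    thus ?thesis using cong2_trans[OF cong] signed_sum_add_mset(2)[OF c(3), of x] 2
      by (intro bexI[of _ 0]) auto
  next
    case 3
    have e: "- (x + c) \<in> \<mu> 3" using third_cube_root[of x c] 3 x by auto
    have "cong2 3 (x + c) (- (x + c))" using mu_subset_cyclo e by (metis cong2_uminus minus_minus subsetD)
    moreover have "signed_sum (add_mset x T) (- (x + c))"
      using signed_sum_uminus[OF signed_sum_add_mset(1)[OF c(3), of x]] by (simp add: add.commute)
    ultimately show ?thesis using cong2_trans[OF cong] e by (intro bexI[of _ "- (x + c)"]) auto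
  qed
qed

section \<open>Roots of unity of order dividing 15\<close>

text \<open>
  Over the field with four elements, sums of roots of order dividing \<open>15\<close> are vectors with five
  coordinates, one for each power of \<open>\<zeta>\<^sub>5\<close>, up to addition of a constant vector. The predicate says
  that \<open>c\<close> is the coordinate vector of \<open>T\<close> read off from its five parts, with entries lifted to zero
  or cube roots of unity: each nonzero entry may be given either sign independently, and it accounts
  for at least one element of \<open>T\<close>.
\<close>
definition coords :: "complex multiset \<Rightarrow> (nat \<Rightarrow> complex) \<Rightarrow> bool" where
  "coords T c \<longleftrightarrow> (\<forall>j. c j \<in> insert 0 (\<mu> 3)) \<and>
     cong2 15 (\<Sum>\<^sub># T) (\<Sum>j<5. \<zeta> 5 ^ j * c j) \<and>
     (\<forall>s. (\<forall>j. s j \<in> {1, - 1}) \<longrightarrow> signed_sum T (\<Sum>j<5. \<zeta> 5 ^ j * (s j * c j))) \<and>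
     card {j. j < 5 \<and> c j \<noteq> 0} \<le> size T"

lemma zero_cube_root_in_cyclo: "c \<in> insert 0 (\<mu> 3) \<Longrightarrow> c \<in> cyclo 3"
  using zero_in_cyclo mu_subset_cyclo by auto

lemma coords_exist:
  assumes "set_mset T \<subseteq> \<mu> 15"
  obtains c where "coords T c"
proof -
  have "prime (5::nat)" by simp
  moreover have "\<not> (5::nat) dvd 3" by simp
  ultimately obtain P where P: "T = glue 5 (\<zeta> 5) P" "\<And>i. set_mset (P i) \<subseteq> \<mu> 3"
    using decompose_unramified[of 5 3 T] assms by auto
  have "\<exists>c. \<forall>j. c j \<in> insert 0 (\<mu> 3) \<and> cong2 3 (\<Sum>\<^sub># (P j)) (c j) \<and> signed_sum (P j) (c j)
      \<and> (c j \<noteq> 0 \<longrightarrow> P j \<noteq> {#})"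
    using reduce_cube_roots[OF P(2)] by (intro choice) blast
  then obtain c where c: "\<And>j. c j \<in> insert 0 (\<mu> 3)" "\<And>j. cong2 3 (\<Sum>\<^sub># (P j)) (c j)"
    "\<And>j. signed_sum (P j) (c j)" "\<And>j. c j \<noteq> 0 \<Longrightarrow> P j \<noteq> {#}" by blast
  have cong: "cong2 15 (\<Sum>j<k. \<zeta> 5 ^ j * \<Sum>\<^sub># (P j)) (\<Sum>j<k. \<zeta> 5 ^ j * c j)" for k
  proof (induction k)
    case (Suc k)
    have "\<zeta> 5 ^ k \<in> cyclo 15" using mu_mono[of 5 15] mu_power[OF \<zeta>_in_mu[of 5]] mu_subset_cyclo by force
    moreover have "cong2 15 (\<Sum>\<^sub># (P k)) (c k)" using c(2) by (rule cong2_mono[rotated]) simp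
    ultimately show ?case using Suc by (simp add: cong2_add cong2_mult)
  qed simp
  have "signed_sum T (\<Sum>j<5. \<zeta> 5 ^ j * (s j * c j))" if s: "\<forall>j. s j \<in> {1, - 1}" for s
  proof -
    have "signed_sum (P j) (s j * c j)" for j
      using s[rule_format, of j] c(3)[of j] signed_sum_uminus[of "P j" "c j"] by auto
    thus ?thesis unfolding P(1) by (intro signed_sum_glue)
  qed
  moreover have "card {j. j < 5 \<and> c j \<noteq> 0} \<le> size T"
  proof -
    have "card {j. j < 5 \<and> c j \<noteq> 0} = (\<Sum>j\<in>{j. j < 5 \<and> c j \<noteq> 0}. 1)" by simp
    also have "\<dots> \<le> (\<Sum>j\<in>{j. j < 5 \<and> c j \<noteq> 0}. size (P j))"
      using c(4) by (intro sum_mono) (auto simp: Suc_le_eq nonempty_has_size)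
    also have "\<dots> \<le> (\<Sum>j<5. size (P j))" by (intro sum_mono2) auto
    finally show ?thesis by (simp add: P(1) size_glue)
  qed
  ultimately show thesis
    using that[of c] c cong[of 5] by (simp add: coords_def P(1) sum_glue)
qed

lemma coords_in: "coords T c \<Longrightarrow> c j \<in> insert 0 (\<mu> 3)"
  unfolding coords_def by (elim conjE) (erule spec)

lemma coords_cong: "coords T c \<Longrightarrow> cong2 15 (\<Sum>\<^sub># T) (\<Sum>j<5. \<zeta> 5 ^ j * c j)"
  unfolding coords_def by (elim conjE)

lemma coords_signed:
  assumes "coords T c" "\<And>j. s j \<in> {1, - 1}"
  shows "signed_sum T (\<Sum>j<5. \<zeta> 5 ^ j * (s j * c j))"
proof -
  have "\<forall>s. (\<forall>j. s j \<in> {1, - 1}) \<longrightarrow> signed_sum T (\<Sum>j<5. \<zeta> 5 ^ j * (s j * c j))"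
    using assms(1) unfolding coords_def by (elim conjE)
  from spec[OF this, of s] show ?thesis using assms(2) by simp
qed

lemma cong2_coords:
  assumes "cong2 15 (\<Sum>j<5. \<zeta> 5 ^ j * c j) 0" "\<And>j. c j \<in> cyclo 3" "i < 5" "j < 5"
  shows "cong2 3 (c i) (c j)"
proof -
  have "cong2 (5 * 3) (\<Sum>j<5. \<zeta> 5 ^ j * c j) 0" using assms(1) by simp
  note rel = this
  have "prime (5::nat)" "(0::nat) < 3" "\<not> (5::nat) dvd 3" by simp_all
  from cong2_unramified[of 5 3 c i j, OF this assms(2) rel assms(3,4)] show ?thesis .
qed

text \<open>
  The coordinate vector of a relation is constant, so taking all signs positive gives a multiple of
  the sum of the fifth roots of unity.
\<close>
lemma liftable_15: "liftable 15 k"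
  unfolding liftable_def
proof (intro allI impI)
  fix S assume S: "set_mset S \<subseteq> \<mu> 15" "cong2 15 (\<Sum>\<^sub># S) 0"
  obtain c where c: "coords S c" using coords_exist[OF S(1)] .
  have c3: "c j \<in> insert 0 (\<mu> 3)" for j using c by (rule coords_in)
  have rel: "cong2 15 (\<Sum>j<5. \<zeta> 5 ^ j * c j) 0"
    using cong2_sym[OF coords_cong[OF c]] S(2) by (rule cong2_trans)
  have "cong2 3 (c j) (c 0)" if "j < 5" for j
    by (rule cong2_coords[OF rel zero_cube_root_in_cyclo[OF c3] that]) simp
  hence const: "c j = c 0" if "j < 5" for j
    using cong2_3_imp_eq[OF c3 c3] that by blast
  have "(\<Sum>j<5. \<zeta> 5 ^ j * (1 * c j)) = (\<Sum>j<5. \<zeta> 5 ^ j * c 0)"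
    by (rule sum.cong[OF refl], subst const) auto
  also have "\<dots> = 0" using sum_\<zeta>_powers[of 5] by (simp flip: sum_distrib_right)
  finally show "signed_sum S 0" using coords_signed[OF c, of "\<lambda>_. 1"] by simp
qed

section \<open>Classes of pairs and order 105\<close>

text \<open>
  A coordinate vector in the class of a pair with entries \<open>a\<close> and \<open>b\<close> at two different places differs
  from that of the pair by a constant vector \<open>d\<close>, which is visible at the three other places.
\<close>
lemma coords_shift:
  assumes c: "coords T c" and ab: "a \<in> \<mu> 3" "b \<in> \<mu> 3" and j: "j1 < 5" "j2 < 5" "j1 \<noteq> j2"
    and cong: "cong2 15 (\<Sum>\<^sub># T) (\<zeta> 5 ^ j1 * a + \<zeta> 5 ^ j2 * b)"
  obtains d where "d \<in> insert 0 (\<mu> 3)" "cong2 3 (c j1) (d + a)" "cong2 3 (c j2) (d + b)"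
    "\<And>j. j < 5 \<Longrightarrow> j \<noteq> j1 \<Longrightarrow> j \<noteq> j2 \<Longrightarrow> c j = d"
proof -
  \<comment> \<open>The coordinates of the pair are added rather than subtracted, which is the same modulo \<open>2\<close>.\<close>
  define x where "x = (\<lambda>j. c j + ((if j = j1 then a else 0) + (if j = j2 then b else 0)))"
  have c3: "c j \<in> insert 0 (\<mu> 3)" for j using c by (rule coords_in)
  have a: "a \<in> cyclo 3" "b \<in> cyclo 3" using ab mu_subset_cyclo by auto
  have x_cyclo: "x j \<in> cyclo 3" for j
    unfolding x_def using c3 zero_cube_root_in_cyclo a zero_in_cyclo by (intro cyclo_add) auto
  have v: "\<zeta> 5 ^ j1 * a + \<zeta> 5 ^ j2 * b \<in> cyclo 15"
    using mu_power[OF \<zeta>_in_mu[of 5]] mu_mono[of 5 15] mu_subset_cyclo cyclo_mono[of 3 15] a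
    by (intro cyclo_add cyclo_mult) (auto dest: subsetD)
  have "(\<Sum>j<5. \<zeta> 5 ^ j * x j) = (\<Sum>j<5. \<zeta> 5 ^ j * c j) + (\<zeta> 5 ^ j1 * a + \<zeta> 5 ^ j2 * b)"
  proof -
    have "(\<Sum>j<5. \<zeta> 5 ^ j * x j) = (\<Sum>j<5. \<zeta> 5 ^ j * c j)
       + ((\<Sum>j<5. if j = j1 then \<zeta> 5 ^ j * a else 0) + (\<Sum>j<5. if j = j2 then \<zeta> 5 ^ j * b else 0))"
      unfolding sum.distrib[symmetric] x_def by (intro sum.cong) (auto simp: algebra_simps)
    thus ?thesis using j by simp
  qed
  moreover have "cong2 15 (\<Sum>j<5. \<zeta> 5 ^ j * c j) (\<zeta> 5 ^ j1 * a + \<zeta> 5 ^ j2 * b)"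
    using cong2_sym[OF coords_cong[OF c]] cong by (rule cong2_trans)
  ultimately have "cong2 15 (\<Sum>j<5. \<zeta> 5 ^ j * x j)
      ((\<zeta> 5 ^ j1 * a + \<zeta> 5 ^ j2 * b) + (\<zeta> 5 ^ j1 * a + \<zeta> 5 ^ j2 * b))"
    by (simp only: cong2_add cong2_refl)
  hence rel: "cong2 15 (\<Sum>j<5. \<zeta> 5 ^ j * x j) 0" using cong2_double[OF v] by (rule cong2_trans)
  note x = cong2_coords[OF rel x_cyclo]
  have "card {j1, j2} < card {..<5::nat}" using j by simp
  hence "\<exists>j3\<in>{..<5}. j3 \<notin> {j1, j2}"
    by (metis card_mono finite.emptyI finite.insertI not_less subsetI)
  then obtain j3 where j3: "j3 < 5" "j3 \<noteq> j1" "j3 \<noteq> j2" by auto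
  have others: "c j = c j3" if "j < 5" "j \<noteq> j1" "j \<noteq> j2" for j
    using x[OF that(1) j3(1)] that j3 cong2_3_imp_eq[OF c3 c3, of j j3] by (simp add: x_def)
  have shift: "cong2 3 y (d + a)" if "cong2 3 (y + a) d" "a \<in> cyclo 3" for y d a
  proof -
    have "cong2 3 (y + a + a) (d + a)" using that by (intro cong2_add) auto
    moreover have "cong2 3 (y + (a + a)) (y + 0)" using that by (intro cong2_add cong2_double) auto
    ultimately show ?thesis using cong2_trans cong2_sym by (metis add.assoc add.right_neutral)
  qed
  show thesis
  proof (rule that)
    show "cong2 3 (c j1) (c j3 + a)" using x[OF j(1) j3(1)] j j3 a by (intro shift) (auto simp: x_def)
    show "cong2 3 (c j2) (c j3 + b)" using x[OF j(2) j3(1)] j j3 a by (intro shift) (auto simp: x_def)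
  qed (use c3 others in auto)
qed

text \<open>
  Addition in the field with four elements, on representatives: a nonzero element is its own negative,
  and two distinct nonzero elements add up to the third.
\<close>
lemma cube_root_shift:
  assumes "c \<in> insert 0 (\<mu> 3)" "d \<in> insert 0 (\<mu> 3)" "a \<in> \<mu> 3" "cong2 3 c (d + a)"
  shows "c = (if d = 0 then a else if d = a then 0 else - (d + a))"
proof -
  consider "d = 0" | "d = a" "d \<noteq> 0" | "d \<in> \<mu> 3" "d \<noteq> a" "d \<noteq> 0" using assms by auto
  thus ?thesis
  proof cases
    case 1
    thus ?thesis using assms by (auto intro: cong2_3_imp_eq)
  next
    case 2
    have "cong2 3 (d + a) 0" unfolding 2 using assms(3) mu_subset_cyclo by (blast intro: cong2_double)
    hence "c = 0" using assms by (intro cong2_3_imp_eq cong2_trans[OF assms(4)]) auto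
    thus ?thesis using 2 by simp
  next
    case 3
    have e: "- (d + a) \<in> \<mu> 3" using 3 assms by (intro third_cube_root) auto
    have "cong2 3 (d + a) (- (d + a))" using mu_subset_cyclo e by (metis cong2_uminus minus_minus subsetD)
    hence "c = - (d + a)" using assms e by (intro cong2_3_imp_eq cong2_trans[OF assms(4)]) auto
    thus ?thesis using 3 by simp
  qed
qed

text \<open>
  The three places that carry \<open>d\<close> get a minus sign, and \<open>d\<close> times the vanishing sum of all
  fifth roots of unity is added. Everything is then concentrated at the two places \<open>j1\<close> and \<open>j2\<close>,
  where the signs are still free.
\<close>
lemma signed_sum_coords:
  assumes c: "coords T c" and j: "j1 < 5" "j2 < 5" "j1 \<noteq> j2"
    and d: "\<And>j. j < 5 \<Longrightarrow> j \<noteq> j1 \<Longrightarrow> j \<noteq> j2 \<Longrightarrow> c j = d" and s: "s1 \<in> {1, -1}" "s2 \<in> {1, -1}"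
  shows "signed_sum T (\<zeta> 5 ^ j1 * (d + s1 * c j1) + \<zeta> 5 ^ j2 * (d + s2 * c j2))"
proof -
  define s where "s = (\<lambda>j. if j = j1 then s1 else if j = j2 then s2 else - 1)"
  have "(\<Sum>j<5. \<zeta> 5 ^ j * (s j * c j)) = (\<Sum>j<5. \<zeta> 5 ^ j * (s j * c j)) + (\<Sum>j<5. \<zeta> 5 ^ j) * d"
    using sum_\<zeta>_powers[of 5] by simp
  also have "\<dots> = (\<Sum>j<5. \<zeta> 5 ^ j * (d + s j * c j))"
    unfolding sum_distrib_right sum.distrib[symmetric]
    by (intro sum.cong refl) (simp add: algebra_simps)
  also have "\<dots> = (\<Sum>j\<in>{j1, j2}. \<zeta> 5 ^ j * (d + s j * c j))"
    using j d by (intro sum.mono_neutral_right) (auto simp: s_def)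
  also have "\<dots> = \<zeta> 5 ^ j1 * (d + s1 * c j1) + \<zeta> 5 ^ j2 * (d + s2 * c j2)"
    using j by (simp add: s_def)
  finally show ?thesis using coords_signed[OF c, of s] s by (simp add: s_def)
qed

lemma nonzero_cube_root: "a \<in> \<mu> 3 \<Longrightarrow> a \<noteq> 0"
  by (auto simp: \<mu>_def)

lemma card_support:
  assumes "coords T c" "A \<subseteq> {..<5}" "\<And>j. j \<in> A \<Longrightarrow> c j \<noteq> 0"
  shows "card A \<le> size T"
proof -
  have "card A \<le> card {j. j < 5 \<and> c j \<noteq> 0}" using assms by (intro card_mono) auto
  thus ?thesis using assms(1) by (simp add: coords_def)
qed

text \<open>
  Let \<open>T\<close> be congruent to a pair of roots at different places \<open>j1\<close>, \<open>j2\<close>, with cube root parts \<open>a\<close> and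
  \<open>b\<close>. Signs on \<open>T\<close> can reproduce the sum or the difference of the pair, depending on the shift \<open>d\<close>.
  For \<open>d = 0\<close> both are attained. If \<open>d\<close> is one of \<open>a\<close>, \<open>b\<close>, then one of the places \<open>j1\<close>, \<open>j2\<close> (or both, if \<open>a = b\<close>)
  becomes zero, and for \<open>a \<noteq> b\<close> the difference is attained at the cost of four nonzero coordinates. For all other
  \<open>d\<close> the sum is attained; for \<open>a \<noteq> b\<close> all five coordinates are then nonzero. For \<open>a = b\<close> the sum is attained
  in every case. So the size of \<open>T\<close> controls which of the two can be had.
\<close>
lemma lift_pair_class:
  assumes T: "set_mset T \<subseteq> \<mu> 15" and ab: "a \<in> \<mu> 3" "b \<in> \<mu> 3" and j: "j1 < 5" "j2 < 5" "j1 \<noteq> j2"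
    and cong: "cong2 15 (\<Sum>\<^sub># T) (\<zeta> 5 ^ j1 * a + \<zeta> 5 ^ j2 * b)"
  defines "sum_lifts \<equiv> signed_sum T (\<zeta> 5 ^ j1 * a + \<zeta> 5 ^ j2 * b)"
    and "diff_lifts \<equiv> signed_sum T (\<zeta> 5 ^ j1 * a - \<zeta> 5 ^ j2 * b)"
  shows "a = b \<Longrightarrow> sum_lifts"
    and "a \<noteq> b \<Longrightarrow> sum_lifts \<or> diff_lifts"
    and "a \<noteq> b \<Longrightarrow> size T \<le> 4 \<Longrightarrow> diff_lifts"
    and "a \<noteq> b \<Longrightarrow> size T \<le> 3 \<Longrightarrow> sum_lifts"
proof -
  obtain c where c: "coords T c" using coords_exist[OF T] .
  have c3: "c j \<in> insert 0 (\<mu> 3)" for j using c by (rule coords_in)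
  obtain d where d: "d \<in> insert 0 (\<mu> 3)" "cong2 3 (c j1) (d + a)" "cong2 3 (c j2) (d + b)"
    "\<And>j. j < 5 \<Longrightarrow> j \<noteq> j1 \<Longrightarrow> j \<noteq> j2 \<Longrightarrow> c j = d"
    using coords_shift[OF c ab j cong] by blast
  note c1 = cube_root_shift[OF c3 d(1) ab(1) d(2)] and c2 = cube_root_shift[OF c3 d(1) ab(2) d(3)]
  note V = signed_sum_coords[OF c j d(4)]
  note nz = nonzero_cube_root[OF ab(1)] nonzero_cube_root[OF ab(2)]
  have d0: "sum_lifts \<and> diff_lifts" if "d = 0"
    using V[of 1 1] V[of 1 "-1"] that c1 c2 by (simp add: sum_lifts_def diff_lifts_def)
  have third: "sum_lifts" if "d \<noteq> 0" "d \<noteq> a" "d \<noteq> b"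
    using signed_sum_uminus[OF V[of 1 1]] that c1 c2 by (simp add: sum_lifts_def algebra_simps)
  have diff_lifts: "diff_lifts" if "a \<noteq> b" "d = a \<or> d = b"
    using that(2)
  proof
    assume "d = a"
    thus ?thesis using V[of 1 1] that(1) nz c1 c2 by (simp add: diff_lifts_def algebra_simps)
  next
    assume "d = b"
    thus ?thesis using signed_sum_uminus[OF V[of 1 1]] that(1) nz c1 c2 by (simp add: diff_lifts_def algebra_simps)
  qed
  have cards: "card ({..<5} - {j1}) = (4::nat)" "card ({..<5} - {j2}) = (4::nat)"
    using j by (simp_all add: card_Diff_subset)
  have big: "5 \<le> size T" if "d \<noteq> 0" "d \<noteq> a" "d \<noteq> b"
  proof -
    have "d + a \<noteq> 0" "d + b \<noteq> 0"
      using that third_cube_root[of d a] third_cube_root[of d b] ab d(1) nonzero_cube_root by force+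
    hence "c j1 \<noteq> 0" "c j2 \<noteq> 0" using that c1 c2 by (auto simp: add_eq_0_iff)
    hence "c j \<noteq> 0" if "j < 5" for j using d(4)[OF that] \<open>d \<noteq> 0\<close> by (cases "j = j1 \<or> j = j2") auto
    thus ?thesis using card_support[OF c, of "{..<5}"] by simp
  qed
  have four: "4 \<le> size T" if "a \<noteq> b" "d = a \<or> d = b"
    using that(2)
  proof
    assume da: "d = a"
    have "a + b \<noteq> 0" using third_cube_root[OF ab that(1)] nonzero_cube_root by force
    hence "c j2 \<noteq> 0" using da that(1) nz c2 by (auto simp: add_eq_0_iff)
    hence "c j \<noteq> 0" if "j < 5" "j \<noteq> j1" for j using d(4)[OF that] da nz by (cases "j = j2") auto
    thus ?thesis using card_support[OF c, of "{..<5} - {j1}"] cards by force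
  next
    assume da: "d = b"
    have "a + b \<noteq> 0" using third_cube_root[OF ab that(1)] nonzero_cube_root by force
    hence "c j1 \<noteq> 0" using da that(1) nz c1 by (auto simp: add_eq_0_iff add.commute)
    hence "c j \<noteq> 0" if "j < 5" "j \<noteq> j2" for j using d(4)[OF that(1) _ that(2)] da nz by (cases "j = j1") auto
    thus ?thesis using card_support[OF c, of "{..<5} - {j2}"] cards by force
  qed
  show "sum_lifts" if "a = b"
  proof (cases "d = a")
    case True
    thus ?thesis using V[of 1 1] that nz c1 c2 by (simp add: sum_lifts_def)
  next
    case False
    thus ?thesis using d0 third that by auto
  qed
  show "sum_lifts \<or> diff_lifts" if "a \<noteq> b" using that d0 third diff_lifts by blast
  show "diff_lifts" if "a \<noteq> b" "size T \<le> 4" using that d0 diff_lifts big by fastforce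
  show "sum_lifts" if "a \<noteq> b" "size T \<le> 3" using that d0 big four by fastforce
qed

text \<open>
  Since \<open>7 * 3 > 18\<close>, some part is a pair \<open>{x, y}\<close>, which determines the class. If \<open>x\<close> and \<open>y\<close>
  lie in the same coset of \<open>\<mu>\<^sub>3\<close>, the class is zero or that of a single root, and relations of order \<open>15\<close>
  lift without restriction. If their cube root parts agree, all parts can be signed to \<open>x + y\<close>. Otherwise
  \<open>x - y\<close> is available for all parts of size at most four. If there is a part of size at least five, the
  remaining six share at most \<open>13\<close> elements, so each has at most three, for which both \<open>x + y\<close> and
  \<open>x - y\<close> are available, and the large part may choose.
\<close>
lemma common_lift:
  fixes T :: "nat \<Rightarrow> complex multiset"
  assumes T: "\<And>i. set_mset (T i) \<subseteq> \<mu> 15" and size: "(\<Sum>i<7. size (T i)) \<le> 18"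
    and two: "\<And>i. i < 7 \<Longrightarrow> 2 \<le> size (T i)"
    and cong: "\<And>i j. i < 7 \<Longrightarrow> j < 7 \<Longrightarrow> cong2 15 (\<Sum>\<^sub># (T i)) (\<Sum>\<^sub># (T j))"
  shows "\<exists>v. \<forall>i<7. signed_sum (T i) v"
proof -
  have "\<exists>i<7. size (T i) \<le> 2"
  proof (rule ccontr)
    assume "\<not> (\<exists>i<7. size (T i) \<le> 2)"
    hence "(\<Sum>i<7::nat. 3) \<le> (\<Sum>i<7. size (T i))" by (intro sum_mono) force
    thus False using size by simp
  qed
  then obtain i0 where i0: "i0 < 7" "size (T i0) \<le> 2" by blast
  hence "size (T i0) = Suc (Suc 0)" using two[of i0] by simp
  then obtain x M where "T i0 = add_mset x M" "size M = Suc 0"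
    by (metis size_eq_Suc_imp_eq_union size_add_mset nat.inject)
  moreover from this obtain y where "M = {#y#}"
    by (metis One_nat_def size_1_singleton_mset)
  ultimately have xy: "T i0 = {#x, y#}" by simp
  have xy_mu: "x \<in> \<mu> (5 * 3)" "y \<in> \<mu> (5 * 3)" using T[of i0] xy by auto
  have D: "\<exists>j<5. \<exists>a\<in>\<mu> 3. z = \<zeta> 5 ^ j * a" if "z \<in> \<mu> (5 * 3)" for z
  proof -
    have "prime (5::nat)" "0 < (3::nat)" "\<not> (5::nat) dvd 3" by simp_all
    from mu_decompose_unramified[OF this that] show ?thesis by blast
  qed
  obtain j1 a where a: "j1 < 5" "a \<in> \<mu> 3" "x = \<zeta> 5 ^ j1 * a" using D[OF xy_mu(1)] by blast
  obtain j2 b where b: "j2 < 5" "b \<in> \<mu> 3" "y = \<zeta> 5 ^ j2 * b" using D[OF xy_mu(2)] by blast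
  have c: "cong2 15 (\<Sum>\<^sub># (T i)) (x + y)" if "i < 7" for i using cong[OF that i0(1)] xy by simp
  consider "x = y" | "j1 = j2" "a \<noteq> b" | "j1 \<noteq> j2" "a = b" | "j1 \<noteq> j2" "a \<noteq> b" using a b by auto
  thus ?thesis
  proof cases
    case 1
    have "y \<in> cyclo 15" using xy_mu mu_subset_cyclo[of 15] by auto
    hence "cong2 15 (x + y) 0" unfolding 1 by (rule cong2_double)
    hence "signed_sum (T i) 0" if "i < 7" for i
      using liftableD[OF liftable_15 T order_refl] cong2_trans[OF c[OF that]] by blast
    thus ?thesis by blast
  next
    case 2
    define u where "u = \<zeta> 5 ^ j1 * - (a + b)"
    have "- (a + b) \<in> \<mu> 15" using third_cube_root[of a b] a b 2 mu_mono[of 3 15] by auto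
    moreover have "\<zeta> 5 ^ j1 \<in> \<mu> 15" using mu_mono[of 5 15] mu_power[OF \<zeta>_in_mu[of 5]] by force
    ultimately have u: "u \<in> \<mu> 15" unfolding u_def by (intro mu_mult)
    have "x + y = - u" using 2 a b by (simp add: u_def algebra_simps)
    hence "cong2 15 (x + y) u" using u mu_subset_cyclo cong2_uminus[of u 15] by auto
    hence "signed_sum (T i) u" if "i < 7" for i
      using liftable_target[OF liftable_15 T lessI u] cong2_trans[OF c[OF that]] by blast
    thus ?thesis by blast
  next
    case 3
    have "signed_sum (T i) (\<zeta> 5 ^ j1 * a + \<zeta> 5 ^ j2 * b)" if "i < 7" for i
      using lift_pair_class(1)[OF T a(2) b(2) a(1) b(1) 3(1) c[OF that, unfolded a(3) b(3)] 3(2)] .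
    thus ?thesis by blast
  next
    case 4
    note L = lift_pair_class(2-4)[OF T a(2) b(2) a(1) b(1) 4(1) _ 4(2), OF c[unfolded a(3) b(3)]]
    show ?thesis
    proof (cases "\<forall>i<7. size (T i) \<le> 4")
      case True
      thus ?thesis using L(2) by blast
    next
      case False
      then obtain i1 where i1: "i1 < 7" "size (T i1) \<ge> 5" by force
      have "size (T i) \<le> 3" if i: "i < 7" "i \<noteq> i1" for i
      proof -
        have "(\<Sum>l\<in>{..<7} - {i, i1}. 2) \<le> (\<Sum>l\<in>{..<7} - {i, i1}. size (T l))"
          using two by (intro sum_mono) auto
        moreover have "card ({..<7} - {i, i1}) = 5" using i i1 by (simp add: card_Diff_subset)
        moreover have "(\<Sum>l<7. size (T l)) = (\<Sum>l\<in>{..<7} - {i, i1}. size (T l)) + (\<Sum>l\<in>{i, i1}. size (T l))"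
          using i i1 by (intro sum.subset_diff) auto
        ultimately show ?thesis using size i i1 by simp
      qed
      hence "signed_sum (T i) (\<zeta> 5 ^ j1 * a + \<zeta> 5 ^ j2 * b) \<and> signed_sum (T i) (\<zeta> 5 ^ j1 * a - \<zeta> 5 ^ j2 * b)"
        if "i < 7" "i \<noteq> i1" for i using L(2,3)[OF that(1)] that by fastforce
      thus ?thesis using L(1)[OF i1(1)] by metis
    qed
  qed
qed

lemma liftable_105: "liftable 105 18"
  unfolding liftable_def
proof (intro allI impI)
  fix S assume S: "set_mset S \<subseteq> \<mu> 105" "size S \<le> 18" "cong2 105 (\<Sum>\<^sub># S) 0"
  have 105: "105 = 7 * (15::nat)" and coprime: "prime (7::nat)" "0 < (15::nat)" "\<not> (7::nat) dvd 15"
    by simp_all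
  obtain T where T: "S = glue 7 (\<zeta> 7) T" "\<And>i. set_mset (T i) \<subseteq> \<mu> 15"
    "\<And>i j. i < 7 \<Longrightarrow> j < 7 \<Longrightarrow> cong2 15 (\<Sum>\<^sub># (T i)) (\<Sum>\<^sub># (T j))"
    using decompose_unramified[OF coprime S(1)[unfolded 105]] S(3)[unfolded 105] by metis
  show "signed_sum S 0"
  proof (cases "\<exists>i<7. size (T i) \<le> 1")
    case True
    then obtain i where "i < 7" "size (T i) \<le> 1" by blast
    thus ?thesis using T S(2) unfolding T(1)
      by (intro signed_sum_of_small_part[OF liftable_15]) auto
  next
    case False
    hence "2 \<le> size (T i)" if "i < 7" for i using that by force
    moreover have "(\<Sum>i<7. size (T i)) \<le> 18" using S(2) by (simp add: T(1) size_glue)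
    ultimately obtain v where "\<forall>i<7. signed_sum (T i) v" using common_lift T by metis
    thus ?thesis unfolding T(1) by (intro signed_sum_glue_const) auto
  qed
qed

section \<open>Arbitrary order\<close>

lemma liftable_mono: "m dvd n \<Longrightarrow> liftable n k \<Longrightarrow> liftable m k"
  unfolding liftable_def using mu_mono[of m n] cong2_mono by blast

lemma dvd_105:
  fixes N :: nat
  assumes "N > 0" "\<And>p. prime p \<Longrightarrow> \<not> p * p dvd N" "\<And>p. prime p \<Longrightarrow> p dvd N \<Longrightarrow> p \<in> {3, 5, 7}"
  shows "N dvd 105"
proof (rule multiplicity_le_imp_dvd)
  fix p :: nat assume p: "prime p"
  show "multiplicity p N \<le> multiplicity p 105"
  proof (cases "p dvd N")
    case True
    hence "p \<in> {3, 5, 7}" using assms(3) p by blast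
    hence "p dvd 105" by auto
    hence "multiplicity p 105 \<ge> 1" using p by (intro multiplicity_geI) auto
    moreover have "multiplicity p N < 2" using assms(1,2) p by (intro multiplicity_lessI) (auto simp: power2_eq_square)
    ultimately show ?thesis by simp
  qed (simp add: not_dvd_imp_multiplicity_0)
qed (use assms in auto)

text \<open>
  Strong induction on the order. A repeated prime factor, the factor \<open>2\<close>, and any prime \<open>p \<ge> 11\<close>
  (for which \<open>18 < 2 * p\<close>) can be removed; what remains divides \<open>105\<close>.
\<close>
lemma liftable_18: "n > 0 \<Longrightarrow> liftable n 18"
proof (induction n rule: less_induct)
  case (less N)
  have step: "liftable N 18" if "prime p" "N = p * n"
    "liftable n 18 \<Longrightarrow> liftable (p * n) 18" for p n
  proof -
    have "n < N" "n > 0" using that less.prems prime_gt_1_nat by auto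
    thus ?thesis using less.IH that by blast
  qed
  consider (ram) p where "prime p" "p * p dvd N"
    | (two) "2 dvd N" "\<And>p::nat. prime p \<Longrightarrow> \<not> p * p dvd N"
    | (large) p where "prime p" "p dvd N" "p \<ge> 11" "\<And>p::nat. prime p \<Longrightarrow> \<not> p * p dvd N"
    | (small) "\<And>p::nat. prime p \<Longrightarrow> \<not> p * p dvd N" "\<And>p. prime p \<Longrightarrow> p dvd N \<Longrightarrow> p \<noteq> 2 \<and> p < 11"
    by (metis not_le)
  thus ?case
  proof cases
    case ram
    then obtain m where m: "N = p * (p * m)" by (auto elim: dvdE simp: mult.assoc)
    show ?thesis using step[OF ram(1) m] liftable_ramified[OF ram(1)] m less.prems by auto
  next
    case two
    then obtain n where n: "N = 2 * n" by (auto elim: dvdE)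
    have "odd n" using two(2)[of 2] n by auto
    thus ?thesis using step[OF two_is_prime_nat n] liftable_double by auto
  next
    case large
    then obtain n where n: "N = p * n" by (auto elim: dvdE)
    have "\<not> p dvd n" using large(4)[OF large(1)] n by auto
    thus ?thesis using step[OF large(1) n] liftable_large_prime[OF large(1)] large n less.prems by auto
  next
    case small
    have "p \<in> {3, 5, 7}" if p: "prime p" "p dvd N" for p
    proof -
      have "p < 11" "p \<noteq> 2" using small(2)[OF p] by auto
      moreover have "p > 1" using p(1) by (rule prime_gt_1_nat)
      moreover have "p \<notin> {4, 6, 8, 9, 10}" using p(1) by auto
      ultimately show ?thesis by force
    qed
    hence "N dvd 105" using small(1) less.prems by (intro dvd_105) auto
    thus ?thesis using liftable_105 liftable_mono by blast
  qed
qed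

lemma cyclotomic_integer_in_cyclo:
  assumes "y \<in> cyclotomic_integers"
  shows "\<exists>n>0. y \<in> cyclo n"
  using assms unfolding cyclotomic_integers_def
proof (induction rule: generate_ring.induct)
  case one
  show ?case using mu_subset_cyclo[of 1] by (intro exI[of _ 1]) (auto simp: one_class)
next
  case (incl h)
  thus ?case using mu_subset_cyclo unfolding roots_of_unity_def \<mu>_def by blast
next
  case (a_inv h)
  thus ?case using cyclo_uminus by (auto simp: uminus_class)
next
  case (eng_add x y)
  then obtain m n where "m > 0" "n > 0" "x \<in> cyclo m" "y \<in> cyclo n" by blast
  thus ?case using cyclo_mono[of m "m * n"] cyclo_mono[of n "m * n"]
    by (intro exI[of _ "m * n"]) (auto simp: plus_class intro!: cyclo_add)
next
  case (eng_mult x y)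
  then obtain m n where "m > 0" "n > 0" "x \<in> cyclo m" "y \<in> cyclo n" by blast
  thus ?case using cyclo_mono[of m "m * n"] cyclo_mono[of n "m * n"]
    by (intro exI[of _ "m * n"]) (auto simp: times_class intro!: cyclo_mult)
qed

lemma mset_roots_of_unity:
  assumes "set_mset S \<subseteq> roots_of_unity"
  shows "\<exists>n>0. set_mset S \<subseteq> \<mu> n"
  using assms
proof (induction S)
  case (add z S)
  then obtain n where n: "n > 0" "set_mset S \<subseteq> \<mu> n" by auto
  obtain m where m: "m > 0" "z \<in> \<mu> m" using add.prems by (auto simp: roots_of_unity_def \<mu>_def)
  show ?case using m n mu_mono[of m "m * n"] mu_mono[of n "m * n"] by (intro exI[of _ "m * n"]) auto
qed (auto intro: exI[of _ 1])

text \<open>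
  A splitting of the multiset of values comes from a splitting of the index set, which gives the signs.
\<close>
lemma signs_of_signed_sum:
  assumes "signed_sum (image_mset \<eta> (mset_set I)) s" "finite I"
  shows "\<exists>\<sigma>. (\<forall>i\<in>I. \<sigma> i \<in> {1, -1}) \<and> (\<Sum>i\<in>I. \<sigma> i * \<eta> i) = s"
proof -
  obtain A B where AB: "image_mset \<eta> (mset_set I) = A + B" "s = \<Sum>\<^sub># A - \<Sum>\<^sub># B"
    using assms unfolding signed_sum_def by blast
  obtain A' B' where A': "mset_set I = A' + B'" "A = image_mset \<eta> A'" "B = image_mset \<eta> B'"
    using image_mset_eq_plusD[OF AB(1)] by blast
  define J where "J = set_mset A'"
  have "J \<subseteq> I" using assms(2) A'(1) unfolding J_def by (metis finite_set_mset_mset_set mset_subset_eq_add_left set_mset_mono)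
  have "mset_set I = mset_set J + mset_set (I - J)"
    using \<open>J \<subseteq> I\<close> assms(2) by (metis Diff_disjoint Un_Diff_cancel finite_Diff finite_subset mset_set_Union sup.absorb2)
  moreover have "A' = mset_set J"
  proof (rule multiset_eqI)
    fix i
    have "count A' i \<le> count (mset_set I) i" by (simp add: A'(1))
    also have "\<dots> \<le> 1" by (simp add: count_mset_set')
    finally have "count A' i \<le> 1" .
    moreover have pos: "count A' i > 0 \<longleftrightarrow> i \<in> J" by (simp add: J_def)
    ultimately have "count A' i = (if i \<in> J then 1 else 0)" proof (cases "i \<in> J")
      case True
      hence "count A' i = 1" using pos \<open>count A' i \<le> 1\<close> by linarith
      thus ?thesis using True by (simp only: if_True)
    next
      case False
      hence "count A' i = 0" using pos by linarith
      thus ?thesis using False by (simp only: if_False)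
    qed
    moreover have "finite J" by (simp add: J_def)
    ultimately show "count A' i = count (mset_set J) i" by (simp add: count_mset_set')
  qed
  ultimately have "B' = mset_set (I - J)" using A'(1) by simp
  hence s: "s = sum \<eta> J - sum \<eta> (I - J)" using \<open>A' = mset_set J\<close> AB A' by (simp add: sum_unfold_sum_mset)
  have "(\<Sum>i\<in>I. (if i \<in> J then 1 else - 1) * \<eta> i) = (\<Sum>i\<in>I-J. (if i \<in> J then 1 else - 1) * \<eta> i) + (\<Sum>i\<in>J. (if i \<in> J then 1 else - 1) * \<eta> i)"
    using \<open>J \<subseteq> I\<close> assms(2) by (intro sum.subset_diff)
  also have "(\<Sum>i\<in>I-J. (if i \<in> J then 1 else - 1) * \<eta> i) = (\<Sum>i\<in>I-J. - \<eta> i)"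
    by (intro sum.cong) auto
  also have "(\<Sum>i\<in>J. (if i \<in> J then 1 else - 1) * \<eta> i) = sum \<eta> J"
    by (intro sum.cong) auto
  also have "(\<Sum>i\<in>I-J. - \<eta> i) + sum \<eta> J = s" by (simp add: s sum_negf)
  finally show ?thesis by (intro exI[of _ "\<lambda>i. if i \<in> J then 1 else - 1"]) auto
qed

theorem theorem6p4:
  fixes S :: "complex multiset" and \<eta> :: "nat \<Rightarrow> complex" and m :: nat
  assumes "S = {# \<eta> i. i \<in># mset_set {1..m} #}"
    and "mod2_cyclotomic_relation S"
    and "size S = m"
    and "m \<le> 18"
  shows "\<exists>\<sigma> :: nat \<Rightarrow> complex. (\<forall>i\<in>{1..m}. \<sigma> i \<in> {1, -1}) \<and> (\<Sum>i=1..m. \<sigma> i * \<eta> i) = 0"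
proof -
  obtain y where y: "set_mset S \<subseteq> roots_of_unity" "y \<in> cyclotomic_integers" "\<Sum>\<^sub># S = 2 * y"
    using assms(2) unfolding mod2_cyclotomic_relation_def by blast
  obtain k where k: "k > 0" "set_mset S \<subseteq> \<mu> k" using mset_roots_of_unity[OF y(1)] by blast
  obtain n where n: "n > 0" "y \<in> cyclo n" using cyclotomic_integer_in_cyclo[OF y(2)] by blast
  have "signed_sum S 0"
  proof (rule liftableD[OF liftable_18])
    show "k * n > 0" using k n by simp
    show "set_mset S \<subseteq> \<mu> (k * n)" using k mu_mono[of k "k * n"] by auto
    have "y \<in> cyclo (k * n)" using n cyclo_mono[of n "k * n"] by auto
    thus "cong2 (k * n) (\<Sum>\<^sub># S) 0" using y(3) by (auto simp: cong2_def)
    show "size S \<le> 18" using assms by simp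
  qed
  thus ?thesis unfolding assms(1) by (rule signs_of_signed_sum) simp
qed

end
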